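(* Let $n \geq 4$ and let $V_1, \dotsc, V_n$ be subspaces of a finite-dimensional vector space $V$ over a field. For indices $i_1,\dots,i_r \in [n]$ write $\langle i_1, \dotsc, i_r\rangle := \dim \sum_{j=1}^r V_{i_j}$. Then \[ \langle 1,2\rangle + \langle 1,3,n\rangle + \langle 3\rangle + \sum_{i=4}^n \bigl( \langle i\rangle + \langle 2,i-1,i\rangle \bigr) \leq \langle 1,3\rangle + \langle 1,n\rangle + \langle 2,3\rangle + \sum_{i=4}^{n} \bigl( \langle 2,i\rangle + \langle i-1, i\rangle \bigr). \] Moreover, this inequality is irreducible: the linear functional $I_n$ on $H_n$ defined by \[ I_n(F) = F(\{1,3\}) + F(\{1,n\}) + F(\{2,3\}) + \sum_{i=4}^n\bigl(F(\{2,i\}) + F(\{i-1,i\})\bigr) - F(\{1,2\}) - F(\{1,3,n\}) - F(\{3\}) - \sum_{i=4}^n\bigl(F(\{i\}) + F(\{2,i-1,i\})\bigr) \] cannot be written as a sum of two nontrivial (i.e.\ not positive multiples of $I_n$) linear functionals which are nonnegative on the rank functions of all arrangements of $n$ subspaces; equivalently, $I_n$ spans an extremal ray of the dual cone $\mathcal{R}_n^{\vee}$. Furthermore, $I_n \notin \varphi_{\#}(\mathcal{R}_k^{\vee})$ for every $k<n$ and every union-preserving map $\varphi\colon \mathcal{P}(k)\to\mathcal{P}(n)$ with $\varphi(\emptyset)=\emptyset$.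
   Context: $[n]=\{1,\dots,n\}$ and $\mathcal{P}(n)$ is the set of subsets of $[n]$. $H_n$ is the real vector space of functions $F\colon \mathcal{P}(n)\to\mathbb{R}$ with $F(\emptyset)=0$; $e_A^*$ (for nonempty $A\subseteq[n]$) is the linear functional $F\mapsto F(A)$. A subspace arrangement $\mathcal{V}=\{V_1,\dots,V_n\}$ over a field $K$ gives the rank function $\mathrm{rk}_{\mathcal{V}}\in H_n$, $\mathrm{rk}_{\mathcal{V}}(A)=\dim\sum_{i\in A}V_i$. $\mathcal{R}_n\subseteq H_n$ is the convex cone generated by all such rank functions (over all fields), and $\mathcal{R}_n^\vee=\{f\in H_n^*: f(c)\ge 0 \text{ for all } c\in\mathcal{R}_n\}$. For a map $\varphi\colon\mathcal{P}(k)\to\mathcal{P}(n)$ with $\varphi(\emptyset)=\emptyset$, $\varphi_{\#}\colon H_k^*\to H_n^*$ is the linear map with $\varphi_{\#}(e_A^* )=e_{\varphi(A)}^*$ (where $e_\emptyset^*=0$). Union-preserving means $\varphi(A\cup B)=\varphi(A)\cup\varphi(B)$. *)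

theory Defs
  imports
    Complex_Main
    "HOL-Library.FuncSet"
    "HOL-Library.Infinite_Typeclass"
    "Jordan_Normal_Form.Missing_VectorSpace"
begin

section \<open>Subspace arrangements\<close>

definition subspace_arrangement ::
    "('a, 'm) ring_scheme \<Rightarrow> ('a, 'b, 'p) module_scheme \<Rightarrow> nat \<Rightarrow> (nat \<Rightarrow> 'b set) \<Rightarrow> bool" where
  "subspace_arrangement K V n W \<longleftrightarrow>
     vectorspace K V \<and> vectorspace.fin_dim K V \<and> (\<forall>i\<in>{1..n}. subspace K (W i) V)"

definition family_sum :: "('a, 'b, 'p) module_scheme \<Rightarrow> (nat \<Rightarrow> 'b set) \<Rightarrow> nat set \<Rightarrow> 'b set" where
  "family_sum V W A = {(\<Oplus>\<^bsub>V\<^esub>i\<in>A. w i) | w. w \<in> Pi A W}"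

definition sum_dim ::
    "('a, 'm) ring_scheme \<Rightarrow> ('a, 'b, 'p) module_scheme \<Rightarrow> (nat \<Rightarrow> 'b set) \<Rightarrow> nat set \<Rightarrow> nat" where
  "sum_dim K V W A = vectorspace.dim K (V\<lparr>carrier := family_sum V W A\<rparr>)"

section \<open>The space \<open>H\<^sub>n\<close> and its dual\<close>

text \<open>A function on the subsets of \<open>{1..n}\<close> is represented by its extension by zero to
  all sets of naturals, so the vector space operations are the pointwise ones.\<close>

definition H_space :: "nat \<Rightarrow> (nat set \<Rightarrow> real) set" where
  "H_space n = {F. F {} = 0 \<and> (\<forall>A. \<not> A \<subseteq> {1..n} \<longrightarrow> F A = 0)}"

text \<open>Functionals are extensional on \<open>H_space n\<close>, so that equality of functionals is
  equality of HOL functions.\<close>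

definition H_dual :: "nat \<Rightarrow> ((nat set \<Rightarrow> real) \<Rightarrow> real) set" where
  "H_dual n = {f \<in> extensional (H_space n).
     (\<forall>F\<in>H_space n. \<forall>G\<in>H_space n. f (\<lambda>A. F A + G A) = f F + f G) \<and>
     (\<forall>c. \<forall>F\<in>H_space n. f (\<lambda>A. c * F A) = c * f F)}"

definition dual_zero :: "nat \<Rightarrow> (nat set \<Rightarrow> real) \<Rightarrow> real" where
  "dual_zero n = (\<lambda>F\<in>H_space n. 0)"

definition dual_add ::
    "nat \<Rightarrow> ((nat set \<Rightarrow> real) \<Rightarrow> real) \<Rightarrow> ((nat set \<Rightarrow> real) \<Rightarrow> real) \<Rightarrow> (nat set \<Rightarrow> real) \<Rightarrow> real" where
  "dual_add n f g = (\<lambda>F\<in>H_space n. f F + g F)"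

definition dual_scale ::
    "nat \<Rightarrow> real \<Rightarrow> ((nat set \<Rightarrow> real) \<Rightarrow> real) \<Rightarrow> (nat set \<Rightarrow> real) \<Rightarrow> real" where
  "dual_scale n c f = (\<lambda>F\<in>H_space n. c * f F)"

definition e_star :: "nat \<Rightarrow> nat set \<Rightarrow> (nat set \<Rightarrow> real) \<Rightarrow> real" where
  "e_star n A = (\<lambda>F\<in>H_space n. F A)"

lemma e_star_empty: "e_star n {} = dual_zero n"
  unfolding e_star_def dual_zero_def by (rule restrict_ext) (simp add: H_space_def)

lemma e_star_in_H_dual: "e_star n A \<in> H_dual n"
  by (auto simp: e_star_def H_dual_def H_space_def)

section \<open>The cone of rank functions and its dual\<close>

definition rank_function ::
    "('a, 'm) ring_scheme \<Rightarrow> ('a, 'b, 'p) module_scheme \<Rightarrow> nat \<Rightarrow> (nat \<Rightarrow> 'b set) \<Rightarrow> nat set \<Rightarrow> real" where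
  "rank_function K V n W = (\<lambda>A. if A \<subseteq> {1..n} then real (sum_dim K V W A) else 0)"

text \<open>Quantification over all fields and all finite-dimensional vector spaces ranges over
  structures whose carriers are subsets of two infinite types \<open>'k\<close> and \<open>'v\<close>. No rank function
  is lost: an arrangement in \<open>K\<^sup>m\<close> is given by finitely many spanning vectors, so it is defined
  over the countable subfield generated by their coordinates, with the same ranks, and every
  countable field and every countable vector space has a copy inside an infinite type.\<close>

definition rank_functions ::
    "'k::infinite itself \<Rightarrow> 'v::infinite itself \<Rightarrow> nat \<Rightarrow> (nat set \<Rightarrow> real) set" where
  "rank_functions TK TV n =
     {rank_function K V n W | (K :: 'k ring) (V :: ('k, 'v) module) W. subspace_arrangement K V n W}"

definition rank_cone ::
    "'k::infinite itself \<Rightarrow> 'v::infinite itself \<Rightarrow> nat \<Rightarrow> (nat set \<Rightarrow> real) set" where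
  "rank_cone TK TV n =
     {(\<lambda>A. \<Sum>G\<in>S. c G * G A) | S c. finite S \<and> S \<subseteq> rank_functions TK TV n \<and> (\<forall>G\<in>S. 0 \<le> c G)}"

definition dual_cone :: "nat \<Rightarrow> (nat set \<Rightarrow> real) set \<Rightarrow> ((nat set \<Rightarrow> real) \<Rightarrow> real) set" where
  "dual_cone n C = {f \<in> H_dual n. \<forall>F\<in>C. 0 \<le> f F}"

definition irreducible_functional ::
    "nat \<Rightarrow> (nat set \<Rightarrow> real) set \<Rightarrow> ((nat set \<Rightarrow> real) \<Rightarrow> real) \<Rightarrow> bool" where
  "irreducible_functional n X h \<longleftrightarrow>
     \<not> (\<exists>f\<in>H_dual n. \<exists>g\<in>H_dual n.
          (\<forall>F\<in>X. 0 \<le> f F) \<and> (\<forall>F\<in>X. 0 \<le> g F) \<and>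
          \<not> (\<exists>c>0. f = dual_scale n c h) \<and> \<not> (\<exists>c>0. g = dual_scale n c h) \<and>
          h = dual_add n f g)"

definition dual_ray :: "nat \<Rightarrow> ((nat set \<Rightarrow> real) \<Rightarrow> real) \<Rightarrow> ((nat set \<Rightarrow> real) \<Rightarrow> real) set" where
  "dual_ray n h = {dual_scale n c h | c. 0 \<le> c}"

definition spans_extremal_ray ::
    "nat \<Rightarrow> ((nat set \<Rightarrow> real) \<Rightarrow> real) set \<Rightarrow> ((nat set \<Rightarrow> real) \<Rightarrow> real) \<Rightarrow> bool" where
  "spans_extremal_ray n D h \<longleftrightarrow>
     h \<in> D \<and> h \<noteq> dual_zero n \<and>
     (\<forall>f\<in>D. \<forall>g\<in>D. dual_add n f g \<in> dual_ray n h \<longrightarrow> f \<in> dual_ray n h \<and> g \<in> dual_ray n h)"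

section \<open>The induced map on duals\<close>

definition union_preserving :: "nat \<Rightarrow> nat \<Rightarrow> (nat set \<Rightarrow> nat set) \<Rightarrow> bool" where
  "union_preserving k n \<phi> \<longleftrightarrow>
     \<phi> \<in> Pow {1..k} \<rightarrow> Pow {1..n} \<and>
     (\<forall>A\<in>Pow {1..k}. \<forall>B\<in>Pow {1..k}. \<phi> (A \<union> B) = \<phi> A \<union> \<phi> B)"

definition unit_fun :: "nat set \<Rightarrow> nat set \<Rightarrow> real" where
  "unit_fun A = (\<lambda>B. if B = A then 1 else 0)"

text \<open>Linear extension from the basis \<open>e_star k A\<close> (\<open>A \<noteq> {}\<close>): the coefficient of \<open>f\<close> at
  \<open>e_star k A\<close> is \<open>f (unit_fun A)\<close>. The lemmas below show that this is the unique linear map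
  with \<open>e_star k A \<mapsto> e_star n (\<phi> A)\<close>.\<close>

definition push_dual ::
    "nat \<Rightarrow> nat \<Rightarrow> (nat set \<Rightarrow> nat set) \<Rightarrow> ((nat set \<Rightarrow> real) \<Rightarrow> real) \<Rightarrow> (nat set \<Rightarrow> real) \<Rightarrow> real" where
  "push_dual k n \<phi> f =
     (\<lambda>F\<in>H_space n. \<Sum>A\<in>Pow {1..k} - {{}}. f (unit_fun A) * e_star n (\<phi> A) F)"

definition dual_linear ::
    "nat \<Rightarrow> nat \<Rightarrow> (((nat set \<Rightarrow> real) \<Rightarrow> real) \<Rightarrow> (nat set \<Rightarrow> real) \<Rightarrow> real) \<Rightarrow> bool" where
  "dual_linear k n T \<longleftrightarrow>
     T \<in> H_dual k \<rightarrow> H_dual n \<and>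
     (\<forall>f\<in>H_dual k. \<forall>g\<in>H_dual k. T (dual_add k f g) = dual_add n (T f) (T g)) \<and>
     (\<forall>c. \<forall>f\<in>H_dual k. T (dual_scale k c f) = dual_scale n c (T f))"

lemma H_space_closed:
  "F \<in> H_space n \<Longrightarrow> G \<in> H_space n \<Longrightarrow> (\<lambda>A. F A + G A) \<in> H_space n"
  "F \<in> H_space n \<Longrightarrow> (\<lambda>A. c * F A) \<in> H_space n"
  "(\<lambda>A. 0) \<in> H_space n"
  by (auto simp: H_space_def)

lemma unit_fun_in_H_space: "A \<in> Pow {1..n} - {{}} \<Longrightarrow> unit_fun A \<in> H_space n"
  by (auto simp: unit_fun_def H_space_def)

lemma H_dual_sum:
  assumes f: "f \<in> H_dual n" and "finite S" and "\<And>s. s \<in> S \<Longrightarrow> u s \<in> H_space n"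
  shows "(\<lambda>B. \<Sum>s\<in>S. c s * u s B) \<in> H_space n \<and>
    f (\<lambda>B. \<Sum>s\<in>S. c s * u s B) = (\<Sum>s\<in>S. c s * f (u s))"
  using assms(2,3)
proof (induction S rule: finite_induct)
  case empty
  have "f (\<lambda>A. c * F A) = c * f F" if "F \<in> H_space n" for c F
    using f that by (simp add: H_dual_def)
  from this[OF H_space_closed(3), of 0] have "f (\<lambda>A. 0) = 0" by simp
  then show ?case by (simp add: H_space_closed(3))
next
  case (insert s S)
  let ?r = "\<lambda>B. \<Sum>s\<in>S. c s * u s B"
  have r: "?r \<in> H_space n" "f ?r = (\<Sum>s\<in>S. c s * f (u s))"
    using insert.IH[OF insert.prems[OF insertI2]] by blast+
  have s: "(\<lambda>B. c s * u s B) \<in> H_space n" "f (\<lambda>B. c s * u s B) = c s * f (u s)"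
    using insert.prems f by (auto intro: H_space_closed simp: H_dual_def)
  have add: "f (\<lambda>A. F A + G A) = f F + f G" if "F \<in> H_space n" "G \<in> H_space n" for F G
    using f that by (simp add: H_dual_def)
  have "f (\<lambda>B. (\<lambda>B. c s * u s B) B + ?r B) = f (\<lambda>B. c s * u s B) + f ?r"
    using add[OF s(1) r(1)] .
  then show ?case
    using H_space_closed(1)[OF s(1) r(1)] insert.hyps r s by simp
qed

lemma H_space_expand:
  assumes "F \<in> H_space n"
  shows "F = (\<lambda>B. \<Sum>A\<in>Pow {1..n} - {{}}. F A * unit_fun A B)"
proof
  fix B
  have "(\<Sum>A\<in>Pow {1..n} - {{}}. F A * unit_fun A B) =
      (\<Sum>A\<in>Pow {1..n} - {{}}. if A = B then F A else 0)"
    by (rule sum.cong) (auto simp: unit_fun_def)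
  also have "\<dots> = F B"
    using assms by (auto simp: H_space_def sum.delta)
  finally show "F B = (\<Sum>A\<in>Pow {1..n} - {{}}. F A * unit_fun A B)" ..
qed

lemma H_dual_expand:
  assumes f: "f \<in> H_dual n" and F: "F \<in> H_space n"
  shows "f F = (\<Sum>A\<in>Pow {1..n} - {{}}. F A * f (unit_fun A))"
proof -
  have "f (\<lambda>B. \<Sum>A\<in>Pow {1..n} - {{}}. F A * unit_fun A B) =
      (\<Sum>A\<in>Pow {1..n} - {{}}. F A * f (unit_fun A))"
    by (rule conjunct2[OF H_dual_sum[OF f]]) (simp, rule unit_fun_in_H_space)
  then show ?thesis using H_space_expand[OF F] by simp
qed

lemma push_dual_linear: "dual_linear k n (push_dual k n \<phi>)"
proof -
  have u: "unit_fun A \<in> H_space k" if "A \<in> Pow {1..k} - {{}}" for A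
    using that by (rule unit_fun_in_H_space)
  have "push_dual k n \<phi> f \<in> H_dual n" for f
    by (auto simp: H_dual_def push_dual_def e_star_def H_space_closed algebra_simps
        sum.distrib sum_distrib_left)
  moreover have "push_dual k n \<phi> (dual_add k f g) =
      dual_add n (push_dual k n \<phi> f) (push_dual k n \<phi> g)" for f g
    unfolding push_dual_def dual_add_def
    by (rule restrict_ext) (simp add: u algebra_simps sum.distrib)
  moreover have "push_dual k n \<phi> (dual_scale k c f) = dual_scale n c (push_dual k n \<phi> f)" for c f
    unfolding push_dual_def dual_scale_def
    by (rule restrict_ext) (simp add: u algebra_simps sum_distrib_left)
  ultimately show ?thesis by (simp add: dual_linear_def)
qed

lemma push_dual_e_star:
  assumes "A \<in> Pow {1..k} - {{}}"
  shows "push_dual k n \<phi> (e_star k A) = e_star n (\<phi> A)"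
proof
  fix F
  show "push_dual k n \<phi> (e_star k A) F = e_star n (\<phi> A) F"
  proof (cases "F \<in> H_space n")
    case True
    have "(\<Sum>B\<in>Pow {1..k} - {{}}. e_star k A (unit_fun B) * e_star n (\<phi> B) F) =
        (\<Sum>B\<in>Pow {1..k} - {{}}. if B = A then e_star n (\<phi> B) F else 0)"
      by (rule sum.cong[OF refl], subst e_star_def)
        (use unit_fun_in_H_space in \<open>auto simp: unit_fun_def\<close>)
    also have "\<dots> = e_star n (\<phi> A) F"
      using assms by (simp add: sum.delta)
    finally show ?thesis using True by (simp add: push_dual_def)
  qed (simp add: push_dual_def e_star_def)
qed

lemma dual_linear_sum:
  assumes T: "dual_linear k n T" and "finite S" and "\<And>s. s \<in> S \<Longrightarrow> v s \<in> H_dual k"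
  shows "(\<lambda>F\<in>H_space k. \<Sum>s\<in>S. c s * v s F) \<in> H_dual k \<and>
    T (\<lambda>F\<in>H_space k. \<Sum>s\<in>S. c s * v s F) = (\<lambda>F\<in>H_space n. \<Sum>s\<in>S. c s * T (v s) F)"
  using assms(2,3)
proof (induction S rule: finite_induct)
  case empty
  have z: "dual_zero k \<in> H_dual k"
    using e_star_in_H_dual[of k "{}"] by (simp add: e_star_empty)
  have "T (dual_scale k 0 (dual_zero k)) = dual_scale n 0 (T (dual_zero k))"
    using T z by (simp add: dual_linear_def)
  then show ?case
    using z by (simp add: dual_scale_def dual_zero_def del: restrict_apply)
next
  case (insert s S)
  let ?r = "\<lambda>F\<in>H_space k. \<Sum>s\<in>S. c s * v s F"
  have r: "?r \<in> H_dual k" "T ?r = (\<lambda>F\<in>H_space n. \<Sum>s\<in>S. c s * T (v s) F)"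
    using insert.IH[OF insert.prems[OF insertI2]] by blast+
  have vs: "v s \<in> H_dual k" using insert by simp
  have sc: "dual_scale k c f \<in> H_dual k" if "f \<in> H_dual k" for c f
    using that by (auto simp: H_dual_def dual_scale_def H_space_closed algebra_simps)
  have ad: "dual_add k f g \<in> H_dual k" if "f \<in> H_dual k" "g \<in> H_dual k" for f g
    using that by (auto simp: H_dual_def dual_add_def H_space_closed algebra_simps)
  have eq: "(\<lambda>F\<in>H_space k. \<Sum>s\<in>insert s S. c s * v s F) = dual_add k (dual_scale k (c s) (v s)) ?r"
    using insert.hyps by (auto simp: dual_add_def dual_scale_def restrict_def)
  have "T (dual_add k (dual_scale k (c s) (v s)) ?r) = dual_add n (dual_scale n (c s) (T (v s))) (T ?r)"
    using T sc[OF vs] r(1) vs by (simp add: dual_linear_def)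
  also have "\<dots> = (\<lambda>F\<in>H_space n. \<Sum>s\<in>insert s S. c s * T (v s) F)"
    using insert.hyps r(2) by (auto simp: dual_add_def dual_scale_def restrict_def)
  finally show ?case
    unfolding eq using ad[OF sc[OF vs] r(1)] by simp
qed

lemma push_dual_unique:
  assumes T: "dual_linear k n T"
    and e: "\<And>A. A \<in> Pow {1..k} - {{}} \<Longrightarrow> T (e_star k A) = e_star n (\<phi> A)"
    and f: "f \<in> H_dual k"
  shows "T f = push_dual k n \<phi> f"
proof -
  let ?S = "Pow {1..k} - {{}}"
  have "f = (\<lambda>F\<in>H_space k. \<Sum>A\<in>?S. f (unit_fun A) * e_star k A F)"
  proof
    fix F
    show "f F = (\<lambda>F\<in>H_space k. \<Sum>A\<in>?S. f (unit_fun A) * e_star k A F) F"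
    proof (cases "F \<in> H_space k")
      case True
      then show ?thesis
        using H_dual_expand[OF f True] by (simp add: e_star_def mult.commute)
    next
      case False
      then show ?thesis using f by (simp add: H_dual_def extensional_def)
    qed
  qed
  then have "T f = T (\<lambda>F\<in>H_space k. \<Sum>A\<in>?S. f (unit_fun A) * e_star k A F)"
    by simp
  also have "\<dots> = (\<lambda>F\<in>H_space n. \<Sum>A\<in>?S. f (unit_fun A) * T (e_star k A) F)"
    by (rule conjunct2[OF dual_linear_sum[OF T]]) (auto intro: e_star_in_H_dual)
  also have "\<dots> = push_dual k n \<phi> f"
    unfolding push_dual_def by (rule restrict_ext, rule sum.cong) (simp_all add: e)
  finally show ?thesis .
qed

section \<open>The functional \<open>I\<^sub>n\<close>\<close>

definition I_functional :: "nat \<Rightarrow> (nat set \<Rightarrow> real) \<Rightarrow> real" where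
  "I_functional n = (\<lambda>F\<in>H_space n.
     F {1, 3} + F {1, n} + F {2, 3} + (\<Sum>i=4..n. F {2, i} + F {i - 1, i})
     - F {1, 2} - F {1, 3, n} - F {3} - (\<Sum>i=4..n. F {i} + F {2, i - 1, i}))"

end

theory Submission
  imports Defs
begin

text \<open>
  Writing \<open>I(A;B|C) = \<langle>A,C\<rangle> + \<langle>B,C\<rangle> - \<langle>C\<rangle> - \<langle>A,B,C\<rangle>\<close>, the inequality says
  \<open>dim (V\<^sub>2 \<inter> V\<^sub>3) \<le> dim (V\<^sub>1 \<inter> V\<^sub>2) + I(3;n|1) + \<Sum>\<^sub>i I(2;i-1|i)\<close>. Intersecting a subspace
  of \<open>V\<^sub>2 \<inter> V\<^bsub>i-1\<^esub>\<close> with \<open>V\<^sub>i\<close> costs at most \<open>I(2;i-1|i)\<close> dimensions, and intersecting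
  a subspace of \<open>V\<^sub>3 \<inter> V\<^sub>n\<close> with \<open>V\<^sub>1\<close> costs at most \<open>I(3;n|1)\<close>; starting from
  \<open>V\<^sub>2 \<inter> V\<^sub>3\<close> one ends inside \<open>V\<^sub>1 \<inter> V\<^sub>2\<close>.

  For extremality, it suffices that a functional \<open>g\<close> vanishing on all rank functions with
  \<open>I\<^sub>n = 0\<close>, and on one with \<open>I\<^sub>n = 1\<close>, is zero. The indicators of the families
  \<open>{A. T \<subseteq> A}\<close>, \<open>T \<noteq> {}\<close>, form a basis of \<open>H\<^sub>n\<close>. Circuit matroids, which are binary, kill
  \<open>g\<close> at every \<open>T\<close> at which \<open>I\<^sub>n\<close> vanishes. The remaining sets \<open>T\<close> are linked in a chain
  starting at \<open>{1,2}\<close>: for suitable tight \<open>S\<close> and \<open>S \<union> {j}\<close>, the difference of the rank-one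
  functions \<open>A \<mapsto> [A \<inter> S \<noteq> {}]\<close> involves exactly two of them, with opposite signs.

  Finally, \<open>\<phi>\<close> is determined by the \<open>k\<close> sets \<open>\<phi> {i}\<close>, and every set in the support of \<open>I\<^sub>n\<close>
  is a union of these. The support contains \<open>{3}, \<dots>, {n}, {1,3}, {2,3}\<close>, which forces \<open>n\<close>
  different sets \<open>\<phi> {i}\<close>.
\<close>

section \<open>Dimensions of spans and sums of subspaces\<close>

context vectorspace
begin

lemma span_insert_eq:
  assumes "insert v S \<subseteq> carrier V" "insert v T \<subseteq> carrier V" "span S = span T"
  shows "span (insert v S) = span (insert v T)"
proof -
  have "span (insert v S) = subspace_sum (span {v}) (span S)"
    using span_union_is_sum[of "{v}" S] assms by simp
  also have "\<dots> = span (insert v T)"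
    using span_union_is_sum[of "{v}" T] assms by simp
  finally show ?thesis .
qed

lemma span_insert_redundant:
  assumes "S \<subseteq> carrier V" "v \<in> span S"
  shows "span (insert v S) = span S"
  using already_in_span[OF assms] by simp

text \<open>Greedy choice: a new vector is kept only when it lies outside the span of those treated
  before.\<close>

lemma lin_indpt_spanning_subset:
  assumes "finite S" "S \<subseteq> carrier V"
  shows "\<exists>B\<subseteq>S. lin_indpt B \<and> span B = span S"
  using assms
proof (induction S rule: finite_induct)
  case empty
  have "lin_indpt {}" unfolding lin_dep_def by blast
  then show ?case by blast
next
  case (insert v S)
  then obtain B where B: "B \<subseteq> S" "lin_indpt B" "span B = span S" by auto
  show ?case
  proof (cases "v \<in> span S")
    case True
    then have "span (insert v S) = span S"
      using insert.prems by (intro span_insert_redundant) auto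
    then show ?thesis using B by blast
  next
    case False
    have "v \<notin> B" using B insert.hyps by blast
    then have "lin_indpt (insert v B)"
      using lin_dep_iff_in_span[of B v] B False insert.prems by auto
    moreover have "span (insert v B) = span (insert v S)"
      using B insert.prems by (intro span_insert_eq) auto
    ultimately show ?thesis using B by (intro exI[of _ "insert v B"]) auto
  qed
qed

section \<open>Rank of a finite set of vectors\<close>

abbreviation rk :: "'c set \<Rightarrow> nat" where
  "rk S \<equiv> vectorspace.dim K (span_vs S)"

lemma rk_lin_indpt:
  assumes "finite B" "B \<subseteq> carrier V" "lin_indpt B"
  shows "rk B = card B"
proof -
  have sub: "subspace K (span B) V" using assms by (intro span_is_subspace)
  interpret B: vectorspace K "span_vs B" using subspace_is_vs[OF sub] .
  have m: "submodule K (span B) V" using sub by simp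
  have BB: "B \<subseteq> span B" using in_own_span assms by blast
  have "B.basis B"
    unfolding B.basis_def using span_li_not_depend[OF BB m] assms BB by auto
  then show ?thesis using B.dim_basis assms by blast
qed

text \<open>If \<open>v\<close> is outside \<open>span S\<close>, an independent subset with the
  same span as \<open>S\<close> stays independent with \<open>v\<close> added. The later rank
  computations run by induction through this one-vector recursion.\<close>

lemma rk_insert:
  assumes "finite S" "insert v S \<subseteq> carrier V"
  shows "rk (insert v S) = rk S + (if v \<in> span S then 0 else 1)"
proof (cases "v \<in> span S")
  case True
  then show ?thesis using span_insert_redundant[of S v] assms by simp
next
  case False
  obtain B where B: "B \<subseteq> S" "lin_indpt B" "span B = span S"
    using lin_indpt_spanning_subset[of S] assms by auto
  have fB: "finite B" using B assms finite_subset by blast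
  have BV: "insert v B \<subseteq> carrier V" using B assms by blast
  have v: "v \<notin> B" using in_own_span[of B] B False BV by auto
  have "lin_indpt (insert v B)"
    using lin_dep_iff_in_span[of B v] B False BV v by auto
  then have "rk (insert v B) = card (insert v B)" using fB BV by (intro rk_lin_indpt) auto
  moreover have "rk B = card B" using fB BV B by (intro rk_lin_indpt) auto
  moreover have "span (insert v B) = span (insert v S)"
    using B assms by (intro span_insert_eq) auto
  ultimately show ?thesis using B fB v False by simp
qed

lemma rk_empty: "rk {} = 0"
proof -
  have "lin_indpt {}" unfolding lin_dep_def by blast
  then show ?thesis using rk_lin_indpt[of "{}"] by simp
qed

text \<open>Adjoining the vectors of \<open>T\<close> to \<open>S\<close> one at a time never lowers
  the rank, and the result has the span of \<open>T\<close>.\<close>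

lemma rk_mono:
  assumes "finite S" "finite T" "S \<subseteq> carrier V" "T \<subseteq> carrier V" "span S \<subseteq> span T"
  shows "rk S \<le> rk T"
proof -
  have *: "rk S \<le> rk (U \<union> S)" if "finite U" "U \<subseteq> carrier V" for U
    using that
  proof (induction U rule: finite_induct)
    case (insert u U)
    then show ?case using rk_insert[of "U \<union> S" u] assms by simp
  qed simp
  have "subspace_sum (span T) (span S) = span T"
  proof -
    have s: "subspace K (span T) V" "subspace K (span S) V"
      using assms by (auto intro: span_is_subspace)
    show ?thesis
      using vsum_is_minimal[OF s(1) s(2) s(1)] in_sum_vs[OF s] assms by auto
  qed
  then have "span (T \<union> S) = span T" using span_union_is_sum assms by simp
  then show ?thesis using *[of T] assms by simp
qed

text \<open>A maximal independent subset of \<open>W\<close> exists because \<open>dim\<close>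
  bounds the size of all of them, and it generates \<open>W\<close>. This brings arbitrary subspaces
  within reach of the rank lemmas for finite sets.\<close>

lemma subspace_eq_span_finite:
  assumes "fin_dim" "subspace K W V"
  obtains B where "finite B" "B \<subseteq> carrier V" "span B = W"
proof -
  let ?P = "\<lambda>S. S \<subseteq> W \<and> lin_indpt S"
  have m: "submodule K W V" using assms by simp
  have WV: "W \<subseteq> carrier V" using m by (rule submodule.subset)
  have "lin_indpt {}" unfolding lin_dep_def by blast
  moreover have "finite A \<and> card A \<le> dim" if "?P A" for A
    using li_le_dim[OF assms(1)] that WV by blast
  ultimately obtain B where B: "finite B" "maximal B ?P"
    using maximal_exists[of ?P dim "{}"] by auto
  interpret W: vectorspace K "vs W" using subspace_is_vs assms by blast
  \<comment> \<open>Maximality was obtained for independence in \<open>V\<close>;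
    \<open>max_li_is_gen\<close> is applied inside \<open>W\<close>, so the two notions have to be
    identified.\<close>
  have eq: "?P = (\<lambda>S. S \<subseteq> carrier (vs W) \<and> W.lin_indpt S)"
    using span_li_not_depend(2)[OF _ m] by fastforce
  have BW: "B \<subseteq> W" using B by (simp add: maximal_def)
  have "W.gen_set B"
    by (rule W.max_li_is_gen) (use B eq in simp)
  then have "span B = W" using span_li_not_depend(1)[OF BW m] by simp
  then show ?thesis using that B BW WV by blast
qed

lemma dim_subspace_mono:
  assumes "fin_dim" "subspace K X V" "subspace K Y V" "X \<subseteq> Y"
  shows "vectorspace.dim K (vs X) \<le> vectorspace.dim K (vs Y)"
proof -
  obtain B where B: "finite B" "B \<subseteq> carrier V" "span B = X"
    using subspace_eq_span_finite assms(1,2) .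
  obtain C where C: "finite C" "C \<subseteq> carrier V" "span C = Y"
    using subspace_eq_span_finite assms(1,3) .
  show ?thesis using rk_mono[of B C] B C assms(4) by simp
qed

lemma subspace_inter:
  assumes "subspace K X V" "subspace K Y V"
  shows "subspace K (X \<inter> Y) V"
proof -
  have m: "submodule K X V" "submodule K Y V" using assms by simp_all
  have "submodule K (X \<inter> Y) V"
  proof (rule submodule.intro)
    show "module K V" by (rule module_axioms)
    show "X \<inter> Y \<subseteq> carrier V" using submodule.subset[OF m(1)] by blast
    show "\<zero>\<^bsub>V\<^esub> \<in> X \<inter> Y" using submodule.zero_closed[OF m(1)] submodule.zero_closed[OF m(2)] by simp
  qed (simp_all add: submodule.m_closed[OF m(1)] submodule.m_closed[OF m(2)]
      submodule.smult_closed[OF m(1)] submodule.smult_closed[OF m(2)])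
  then show ?thesis using assms by (simp add: subspace_def)
qed

lemma subspace_diff_closed:
  assumes "subspace K X V" "a \<in> X" "a \<oplus>\<^bsub>V\<^esub> b \<in> X" "b \<in> carrier V"
  shows "b \<in> X"
proof -
  have m: "submodule K X V" using assms by simp
  have a: "a \<in> carrier V" using m assms submodule.subset by blast
  have "(\<ominus>\<^bsub>K\<^esub> \<one>\<^bsub>K\<^esub>) \<odot>\<^bsub>V\<^esub> a \<in> X" using submodule.smult_closed[OF m] assms(2) by simp
  then have "\<ominus>\<^bsub>V\<^esub> a \<in> X" using a smult_l_minus smult_one by simp
  then have "\<ominus>\<^bsub>V\<^esub> a \<oplus>\<^bsub>V\<^esub> (a \<oplus>\<^bsub>V\<^esub> b) \<in> X"
    using submodule.m_closed[OF m] assms(3) by simp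
  then show ?thesis using a assms by (simp add: M.r_neg1)
qed

text \<open>Adjoining the vectors of a generating set of \<open>X\<close> one at a time to \<open>X \<inter> Y\<close> and to \<open>Y\<close>
  raises both dimensions simultaneously.\<close>

lemma dim_sum_add_dim_inter:
  assumes "fin_dim" and X: "subspace K X V" and Y: "subspace K Y V"
  shows "vectorspace.dim K (vs (subspace_sum X Y)) + vectorspace.dim K (vs (X \<inter> Y))
       = vectorspace.dim K (vs X) + vectorspace.dim K (vs Y)"
proof -
  have XY: "subspace K (X \<inter> Y) V" using subspace_inter X Y .
  obtain B where B: "finite B" "B \<subseteq> carrier V" "span B = X"
    using subspace_eq_span_finite assms(1) X .
  obtain C where C: "finite C" "C \<subseteq> carrier V" "span C = Y"
    using subspace_eq_span_finite assms(1) Y .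
  obtain H where H: "finite H" "H \<subseteq> carrier V" "span H = X \<inter> Y"
    using subspace_eq_span_finite assms(1) XY .
  have BX: "B \<subseteq> X" using in_own_span B by blast
  have HX: "H \<subseteq> X" "H \<subseteq> Y" using in_own_span[of H] H by blast+
  have XV: "X \<subseteq> carrier V" "Y \<subseteq> carrier V" using X Y is_module submodule.subset by blast+
  have mX: "submodule K X V" using X by simp
  have *: "rk (S \<union> C) + rk H = rk (S \<union> H) + rk C" if "finite S" "S \<subseteq> X" for S
    using that
  proof (induction S rule: finite_induct)
    case (insert v S)
    have S: "S \<subseteq> carrier V" "insert v S \<subseteq> carrier V" using insert.prems XV by auto
    have spS: "span S \<subseteq> X" using span_is_subset[OF _ mX, of S] insert.prems by blast
    \<comment> \<open>Modular law: if \<open>v\<close> is \<open>a\<close> plus \<open>b\<close>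
      with \<open>a\<close> in \<open>span S\<close> and \<open>b\<close> in \<open>Y\<close>, then
      \<open>b\<close> is a difference of elements of \<open>X\<close>, so it already lies in
      \<open>span H\<close>.\<close>
    have "v \<in> span (S \<union> C) \<longleftrightarrow> v \<in> span (S \<union> H)"
    proof
      assume "v \<in> span (S \<union> C)"
      then obtain a b where ab: "a \<in> span S" "b \<in> Y" "v = a \<oplus>\<^bsub>V\<^esub> b"
        using span_union_is_sum[of S C] S C by (auto simp: submodule_sum_def)
      then have "b \<in> X" using subspace_diff_closed[OF X, of a b] spS insert.prems XV by auto
      then show "v \<in> span (S \<union> H)"
        using span_union_is_sum[of S H] S H ab by (auto simp: submodule_sum_def)
    next
      assume "v \<in> span (S \<union> H)"
      then show "v \<in> span (S \<union> C)"
        using span_union_is_sum[of S H] span_union_is_sum[of S C] S H C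
        by (auto simp: submodule_sum_def)
    qed
    then show ?case
      using rk_insert[of "S \<union> C" v] rk_insert[of "S \<union> H" v] insert S C H by simp
  qed simp
  have "span (B \<union> C) = subspace_sum X Y" using span_union_is_sum B C by simp
  moreover have "span (B \<union> H) = X"
  proof -
    have "subspace_sum X (X \<inter> Y) = X"
      using vsum_is_minimal[OF X XY X] in_sum_vs[OF X XY] by auto
    then show ?thesis using span_union_is_sum B H by simp
  qed
  ultimately show ?thesis using *[OF B(1) BX] B C H by simp
qed

section \<open>Sums of families of subspaces\<close>

lemma family_sum_insert:
  assumes "finite A" "i \<notin> A" "\<And>j. j \<in> insert i A \<Longrightarrow> W j \<subseteq> carrier V"
  shows "family_sum V W (insert i A) = subspace_sum (W i) (family_sum V W A)"
proof (intro equalityI subsetI)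
  fix x assume "x \<in> family_sum V W (insert i A)"
  then obtain w where w: "w \<in> Pi (insert i A) W" "x = (\<Oplus>\<^bsub>V\<^esub>j\<in>insert i A. w j)"
    by (auto simp: family_sum_def)
  have "w j \<in> carrier V" if "j \<in> insert i A" for j
    using Pi_mem[OF w(1) that] assms(3)[OF that] by blast
  then have "x = w i \<oplus>\<^bsub>V\<^esub> (\<Oplus>\<^bsub>V\<^esub>j\<in>A. w j)"
    unfolding w(2) using assms(1,2) by (intro M.finsum_insert) simp_all
  moreover have "(\<Oplus>\<^bsub>V\<^esub>j\<in>A. w j) \<in> family_sum V W A" using w by (auto simp: family_sum_def)
  ultimately show "x \<in> subspace_sum (W i) (family_sum V W A)"
    using w by (auto simp: submodule_sum_def)
next
  fix x assume "x \<in> subspace_sum (W i) (family_sum V W A)"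
  then obtain a w where w: "a \<in> W i" "w \<in> Pi A W" "x = a \<oplus>\<^bsub>V\<^esub> (\<Oplus>\<^bsub>V\<^esub>j\<in>A. w j)"
    by (auto simp: submodule_sum_def family_sum_def)
  let ?w = "w(i := a)"
  have "(\<Oplus>\<^bsub>V\<^esub>j\<in>A. ?w j) = (\<Oplus>\<^bsub>V\<^esub>j\<in>A. w j)"
    using assms w by (intro M.finsum_cong') (auto simp: Pi_def subset_iff)
  moreover have "(\<Oplus>\<^bsub>V\<^esub>j\<in>insert i A. ?w j) = ?w i \<oplus>\<^bsub>V\<^esub> (\<Oplus>\<^bsub>V\<^esub>j\<in>A. ?w j)"
    using assms w by (intro M.finsum_insert) (auto simp: Pi_def subset_iff)
  ultimately have "(\<Oplus>\<^bsub>V\<^esub>j\<in>insert i A. ?w j) = x"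
    using w(3) by (simp only: fun_upd_same)
  moreover have "?w \<in> Pi (insert i A) W" using w by (auto simp: Pi_def)
  ultimately show "x \<in> family_sum V W (insert i A)"
    unfolding family_sum_def by blast
qed

lemma family_sum_span:
  assumes "finite A" "\<And>i. i \<in> A \<Longrightarrow> G i \<subseteq> carrier V"
  shows "family_sum V (\<lambda>i. span (G i)) A = span (\<Union>i\<in>A. G i)"
  using assms
proof (induction A rule: finite_induct)
  case empty
  have "family_sum V (\<lambda>i. span (G i)) {} = {\<zero>\<^bsub>V\<^esub>}"
    by (auto simp: family_sum_def)
  then show ?case by (simp add: span_empty)
next
  case (insert i A)
  have "family_sum V (\<lambda>i. span (G i)) (insert i A)
      = subspace_sum (span (G i)) (family_sum V (\<lambda>i. span (G i)) A)"
    using insert by (intro family_sum_insert) (auto simp: span_is_subset2)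
  also have "\<dots> = span (G i \<union> (\<Union>i\<in>A. G i))"
    using insert span_union_is_sum[of "G i" "\<Union>i\<in>A. G i"] by (auto simp: UN_subset_iff)
  finally show ?case by simp
qed

text \<open>This characterises the sum as a join in the lattice of subspaces. The facts about
  \<open>\<sigma>\<close> needed for the inequality come from it, without choosing summands.\<close>

lemma family_sum_subspace_least:
  assumes "finite A" "\<And>i. i \<in> A \<Longrightarrow> subspace K (W i) V"
  shows "subspace K (family_sum V W A) V \<and>
    (\<forall>X. subspace K X V \<longrightarrow> (family_sum V W A \<subseteq> X \<longleftrightarrow> (\<forall>i\<in>A. W i \<subseteq> X)))"
  using assms
proof (induction A rule: finite_induct)
  case empty
  have e: "family_sum V W {} = span {}"
    by (auto simp: family_sum_def span_empty)
  have "\<zero>\<^bsub>V\<^esub> \<in> X" if "subspace K X V" for X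
    using submodule.zero_closed[OF is_module[OF that]] .
  then show ?case using span_is_subspace[of "{}"] by (auto simp: e span_empty)
next
  case (insert i A)
  have W: "W j \<subseteq> carrier V" if "j \<in> insert i A" for j
    using submodule.subset[OF is_module[OF insert.prems[OF that]]] .
  have eq: "family_sum V W (insert i A) = subspace_sum (W i) (family_sum V W A)"
    using insert W by (intro family_sum_insert) auto
  have s: "subspace K (W i) V" "subspace K (family_sum V W A) V" using insert by auto
  show ?case
    unfolding eq using sum_is_subspace[OF s] vsum_is_minimal[OF s] insert by auto
qed

end

section \<open>The inequality\<close>

locale arrangement = vectorspace K V
  for K :: "('a, 'm) ring_scheme" and V :: "('a, 'b, 'p) module_scheme" +
  fixes n :: nat and W :: "nat \<Rightarrow> 'b set"
  assumes fin_dim: "fin_dim" and subspaces: "i \<in> {1..n} \<Longrightarrow> subspace K (W i) V"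
begin

abbreviation "\<sigma> \<equiv> family_sum V W"
abbreviation "r \<equiv> sum_dim K V W"
abbreviation d :: "'b set \<Rightarrow> nat" where "d X \<equiv> vectorspace.dim K (vs X)"

lemma sigma_subspace: "A \<subseteq> {1..n} \<Longrightarrow> subspace K (\<sigma> A) V"
  using family_sum_subspace_least[of A W] subspaces finite_subset[of A "{1..n}"] by blast

lemma sigma_le_iff:
  "A \<subseteq> {1..n} \<Longrightarrow> subspace K X V \<Longrightarrow> \<sigma> A \<subseteq> X \<longleftrightarrow> (\<forall>i\<in>A. W i \<subseteq> X)"
  using family_sum_subspace_least[of A W] subspaces finite_subset[of A "{1..n}"] by blast

lemma sigma_upper: "A \<subseteq> {1..n} \<Longrightarrow> i \<in> A \<Longrightarrow> W i \<subseteq> \<sigma> A"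
  using sigma_le_iff[OF _ sigma_subspace] by blast

lemma sigma_single: "i \<in> {1..n} \<Longrightarrow> \<sigma> {i} = W i"
  using sigma_le_iff[of "{i}" "W i"] sigma_upper[of "{i}" i] subspaces[of i] by auto

lemma sigma_Un:
  assumes "A \<subseteq> {1..n}" "B \<subseteq> {1..n}"
  shows "\<sigma> (A \<union> B) = subspace_sum (\<sigma> A) (\<sigma> B)"
proof
  note s = sigma_subspace[OF assms(1)] sigma_subspace[OF assms(2)]
  have AB: "A \<union> B \<subseteq> {1..n}" using assms by blast
  show "subspace_sum (\<sigma> A) (\<sigma> B) \<subseteq> \<sigma> (A \<union> B)"
    using vsum_is_minimal[OF s sigma_subspace[OF AB]] sigma_upper[OF AB]
      sigma_le_iff[OF assms(1) sigma_subspace[OF AB]]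
      sigma_le_iff[OF assms(2) sigma_subspace[OF AB]] by blast
  have "\<sigma> A \<subseteq> subspace_sum (\<sigma> A) (\<sigma> B)" "\<sigma> B \<subseteq> subspace_sum (\<sigma> A) (\<sigma> B)"
    using in_sum_vs[OF s] in_sum_vs[OF s(2,1)] vsum_comm[OF s] by auto
  then show "\<sigma> (A \<union> B) \<subseteq> subspace_sum (\<sigma> A) (\<sigma> B)"
    using sigma_le_iff[OF AB sum_is_subspace[OF s]] sigma_upper[OF assms(1)]
      sigma_upper[OF assms(2)] by blast
qed

lemma sum_dim_modular:
  assumes "A \<subseteq> {1..n}" "B \<subseteq> {1..n}"
  shows "r (A \<union> B) + d (\<sigma> A \<inter> \<sigma> B) = r A + r B"
  using dim_sum_add_dim_inter[OF fin_dim sigma_subspace[OF assms(1)] sigma_subspace[OF assms(2)]]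
  by (simp add: sum_dim_def sigma_Un[OF assms])

text \<open>The loss from \<open>X\<close> to \<open>X \<inter> W i\<close> is the dimension of
  \<open>subspace_sum X (W i)\<close> minus that of \<open>W i\<close>. This sum lies in both
  \<open>\<sigma> {a, i}\<close> and \<open>\<sigma> {b, i}\<close>, and
  \<open>sum_dim_modular\<close> measures their intersection. Everything is written additively
  because ranks are naturals.\<close>

lemma dim_inter_step:
  assumes X: "subspace K X V" "X \<subseteq> W a" "X \<subseteq> W b"
    and n: "a \<in> {1..n}" "b \<in> {1..n}" "i \<in> {1..n}"
  shows "d X + r {i} + r {a, b, i} \<le> d (X \<inter> W i) + r {a, i} + r {b, i}"
proof -
  have Wi: "subspace K (W i) V" using subspaces n by blast
  have ai: "{a, i} \<subseteq> {1..n}" and bi: "{b, i} \<subseteq> {1..n}" using n by auto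
  have "X \<subseteq> \<sigma> {a, i}" "W i \<subseteq> \<sigma> {a, i}" "X \<subseteq> \<sigma> {b, i}" "W i \<subseteq> \<sigma> {b, i}"
    using sigma_upper[OF ai, of a] sigma_upper[OF ai, of i]
      sigma_upper[OF bi, of b] sigma_upper[OF bi, of i] X by simp_all
  then have "subspace_sum X (W i) \<subseteq> \<sigma> {a, i} \<inter> \<sigma> {b, i}"
    using vsum_is_minimal[OF X(1) Wi sigma_subspace[OF ai]]
      vsum_is_minimal[OF X(1) Wi sigma_subspace[OF bi]] by simp
  then have "d (subspace_sum X (W i)) \<le> d (\<sigma> {a, i} \<inter> \<sigma> {b, i})"
    using sum_is_subspace[OF X(1) Wi] subspace_inter[OF sigma_subspace[OF ai] sigma_subspace[OF bi]]
    by (intro dim_subspace_mono[OF fin_dim])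
  moreover have "d (subspace_sum X (W i)) + d (X \<inter> W i) = d X + r {i}"
    using dim_sum_add_dim_inter[OF fin_dim X(1) Wi] sigma_single[OF n(3)] by (simp add: sum_dim_def)
  moreover have "{a, i} \<union> {b, i} = {a, b, i}" by blast
  ultimately show ?thesis using sum_dim_modular[OF ai bi] by simp
qed

text \<open>The witness is the intersection of \<open>W 2\<close> up to \<open>W m\<close>. Lying in
  \<open>W 2\<close> and \<open>W m\<close> allows the next step, with \<open>W (Suc m)\<close>;
  lying in \<open>W 3\<close> is saved for the closing step with \<open>W 1\<close>.\<close>

lemma dim_common_chain:
  assumes "3 \<le> m" "m \<le> n"
  shows "\<exists>X. subspace K X V \<and> X \<subseteq> W 2 \<and> X \<subseteq> W 3 \<and> X \<subseteq> W m \<and>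
    r {2} + r {3} + (\<Sum>i=4..m. r {i} + r {2, i - 1, i})
      \<le> r {2, 3} + d X + (\<Sum>i=4..m. r {2, i} + r {i - 1, i})"
  using assms
proof (induction m rule: nat_induct_at_least)
  case base
  then have n: "{2} \<subseteq> {1..n}" "{3} \<subseteq> {1..n}" by auto
  then have s: "\<sigma> {2} = W 2" "\<sigma> {3} = W 3" using sigma_single by auto
  have "r {2, 3} + d (W 2 \<inter> W 3) = r {2} + r {3}"
    using sum_dim_modular[OF n] s by (simp add: insert_commute)
  moreover have "subspace K (W 2 \<inter> W 3) V" using n subspaces by (intro subspace_inter) auto
  ultimately show ?case by (intro exI[of _ "W 2 \<inter> W 3"]) auto
next
  case (Suc m)
  then obtain X where X: "subspace K X V" "X \<subseteq> W 2" "X \<subseteq> W 3" "X \<subseteq> W m"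
    "r {2} + r {3} + (\<Sum>i=4..m. r {i} + r {2, i - 1, i})
      \<le> r {2, 3} + d X + (\<Sum>i=4..m. r {2, i} + r {i - 1, i})"
    by auto
  have "d X + r {Suc m} + r {2, m, Suc m} \<le> d (X \<inter> W (Suc m)) + r {2, Suc m} + r {m, Suc m}"
    using Suc X by (intro dim_inter_step) auto
  moreover have "subspace K (X \<inter> W (Suc m)) V"
    using Suc X subspaces by (intro subspace_inter) auto
  moreover have "{4..Suc m} = insert (Suc m) {4..m}" using Suc by auto
  ultimately show ?case using X by (intro exI[of _ "X \<inter> W (Suc m)"]) auto
qed

lemma sum_dim_inequality:
  assumes "n \<ge> 4"
  shows "r {1, 2} + r {1, 3, n} + r {3} + (\<Sum>i=4..n. r {i} + r {2, i - 1, i})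
    \<le> r {1, 3} + r {1, n} + r {2, 3} + (\<Sum>i=4..n. r {2, i} + r {i - 1, i})"
proof -
  obtain X where X: "subspace K X V" "X \<subseteq> W 2" "X \<subseteq> W 3" "X \<subseteq> W n"
    "r {2} + r {3} + (\<Sum>i=4..n. r {i} + r {2, i - 1, i})
      \<le> r {2, 3} + d X + (\<Sum>i=4..n. r {2, i} + r {i - 1, i})"
    using dim_common_chain[of n] assms by auto
  have n: "{1} \<subseteq> {1..n}" "{2} \<subseteq> {1..n}" using assms by auto
  then have s: "\<sigma> {1} = W 1" "\<sigma> {2} = W 2" using sigma_single by auto
  \<comment> \<open>Closing step: the pair is now \<open>W 3\<close> and \<open>W n\<close>. The
    result lies in \<open>W 1 \<inter> W 2\<close> because \<open>X\<close> has stayed inside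
    \<open>W 2\<close>.\<close>
  have "d X + r {1} + r {3, n, 1} \<le> d (X \<inter> W 1) + r {3, 1} + r {n, 1}"
    using assms X by (intro dim_inter_step) auto
  then have "d X + r {1} + r {1, 3, n} \<le> d (X \<inter> W 1) + r {1, 3} + r {1, n}"
    by (simp add: insert_commute)
  moreover have "d (X \<inter> W 1) \<le> d (W 1 \<inter> W 2)"
    using X subspaces assms by (intro dim_subspace_mono[OF fin_dim] subspace_inter) auto
  moreover have "r {1, 2} + d (W 1 \<inter> W 2) = r {1} + r {2}"
    using sum_dim_modular[OF n] s by (simp add: insert_commute)
  ultimately show ?thesis using X(5) by linarith
qed

end

section \<open>Binary rank functions\<close>

text \<open>The two-element field, placed on two chosen elements of \<open>'k\<close> because
  \<open>rank_functions\<close> prescribes the type of scalars.\<close>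

definition gf2 :: "'k \<Rightarrow> 'k \<Rightarrow> 'k ring" where
  "gf2 z u = \<lparr>carrier = {z, u}, mult = (\<lambda>x y. if x = u then y else z), one = u,
     zero = z, add = (\<lambda>x y. if x = y then z else u)\<rparr>"

lemma field_gf2:
  assumes "z \<noteq> u"
  shows "field (gf2 z u)"
proof (rule cring.cring_fieldI)
  show "cring (gf2 z u)"
  proof (rule cringI)
    show "abelian_group (gf2 z u)"
      by (rule abelian_groupI) (auto simp: gf2_def)
    show "Group.comm_monoid (gf2 z u)"
      by (rule comm_monoidI) (auto simp: gf2_def)
  qed (use assms in \<open>auto simp: gf2_def\<close>)
  show "Units (gf2 z u) = carrier (gf2 z u) - {\<zero>\<^bsub>gf2 z u\<^esub>}"
    using assms by (auto simp: gf2_def Units_def)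
qed

text \<open>The power set of \<open>X\<close> under symmetric difference, transported along \<open>enc\<close> since the
  carriers in \<open>rank_functions\<close> must lie in a prescribed type. The fields \<open>mult\<close> and \<open>one\<close> are junk.\<close>

definition pow_space :: "'k \<Rightarrow> (nat set \<Rightarrow> 'v) \<Rightarrow> nat set \<Rightarrow> ('k, 'v) module" where
  "pow_space u enc X = \<lparr>carrier = enc ` Pow X, mult = (\<lambda>x y. enc {}), one = enc {}, zero = enc {},
     add = (\<lambda>x y. enc (sym_diff (inv_into (Pow X) enc x) (inv_into (Pow X) enc y))),
     smult = (\<lambda>c x. if c = u then x else enc {})\<rparr>"

locale encoded_pow_space =
  fixes z u :: 'k and enc :: "nat set \<Rightarrow> 'v" and X :: "nat set"
  assumes zu: "z \<noteq> u" and finite_X: "finite X" and inj: "inj_on enc (Pow X)"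
begin

abbreviation "K2 \<equiv> gf2 z u"
abbreviation "P \<equiv> pow_space u enc X"

lemma P_simps [simp]:
  "carrier P = enc ` Pow X" "\<zero>\<^bsub>P\<^esub> = enc {}"
  "A \<subseteq> X \<Longrightarrow> B \<subseteq> X \<Longrightarrow> enc A \<oplus>\<^bsub>P\<^esub> enc B = enc (sym_diff A B)"
  "c \<odot>\<^bsub>P\<^esub> x = (if c = u then x else enc {})"
  using inj by (auto simp: pow_space_def)

lemma enc_eq_iff: "A \<subseteq> X \<Longrightarrow> B \<subseteq> X \<Longrightarrow> enc A = enc B \<longleftrightarrow> A = B"
  using inj by (auto simp: inj_on_eq_iff)

lemma vectorspace_P: "vectorspace K2 P"
proof (rule vs_criteria)
  show "field K2" using zu by (rule field_gf2)
  have D: "sym_diff A B \<subseteq> X" if "A \<subseteq> X" "B \<subseteq> X" for A B using that by blast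
  show "\<forall>v w. v \<in> carrier P \<and> w \<in> carrier P \<longrightarrow> v \<oplus>\<^bsub>P\<^esub> w \<in> carrier P"
    using D by auto
  show "\<forall>v\<in>carrier P. \<exists>w\<in>carrier P. v \<oplus>\<^bsub>P\<^esub> w = \<zero>\<^bsub>P\<^esub>"
    by auto (metis Diff_cancel P_simps(3) PowI Un_empty image_eqI)
  show "\<forall>v w. v \<in> carrier P \<and> w \<in> carrier P \<longrightarrow> v \<oplus>\<^bsub>P\<^esub> w = w \<oplus>\<^bsub>P\<^esub> v"
    by (auto simp: Un_commute)
  have "enc A \<oplus>\<^bsub>P\<^esub> enc B \<oplus>\<^bsub>P\<^esub> enc C = enc A \<oplus>\<^bsub>P\<^esub> (enc B \<oplus>\<^bsub>P\<^esub> enc C)"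
    if "A \<subseteq> X" "B \<subseteq> X" "C \<subseteq> X" for A B C
  proof -
    have "sym_diff (sym_diff A B) C = sym_diff A (sym_diff B C)" by blast
    then show ?thesis using that by (simp only: P_simps(3) D)
  qed
  then show "\<forall>v w x. v \<in> carrier P \<and> w \<in> carrier P \<and> x \<in> carrier P \<longrightarrow>
      v \<oplus>\<^bsub>P\<^esub> w \<oplus>\<^bsub>P\<^esub> x = v \<oplus>\<^bsub>P\<^esub> (w \<oplus>\<^bsub>P\<^esub> x)"
    unfolding P_simps(1) by blast
qed (use zu in \<open>auto simp: gf2_def\<close>)

sublocale vectorspace K2 P by (rule vectorspace_P)

lemma fin_dim_P: "fin_dim"
proof -
  have "span (carrier P) = carrier P"
    using in_own_span[of "carrier P"] span_is_subset2[of "carrier P"] by auto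
  then show ?thesis unfolding fin_dim_def using finite_X by (intro exI[of _ "carrier P"]) auto
qed

lemma span_single: "Y \<subseteq> X \<Longrightarrow> span {enc Y} = {enc {}, enc Y}"
proof -
  assume Y: "Y \<subseteq> X"
  have "span {enc Y} = {lincomb a {enc Y} | a. a \<in> {enc Y} \<rightarrow> carrier K2}"
    using Y by (intro finite_span) auto
  also have "lincomb a {enc Y} = a (enc Y) \<odot>\<^bsub>P\<^esub> enc Y" if "a \<in> {enc Y} \<rightarrow> carrier K2" for a
    using lincomb_insert[of "{}" a "enc Y"] that Y
    by (cases "a (enc Y) = u") auto
  then have "{lincomb a {enc Y} | a. a \<in> {enc Y} \<rightarrow> carrier K2}
      = {c \<odot>\<^bsub>P\<^esub> enc Y | c. c \<in> carrier K2}"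
    by (auto simp del: P_simps(4)) (rule exI[of _ "\<lambda>_. _"], auto)
  finally show ?thesis using zu by (auto simp: gf2_def)
qed

text \<open>Over two scalars the line through \<open>enc Y\<close> has only two points, so a new
  generator adds just one translate of the old span.\<close>

lemma span_insert_enc:
  assumes "Y \<subseteq> X" "F \<subseteq> Pow X" "S \<subseteq> carrier P" "span S = enc ` F"
  shows "span (insert (enc Y) S) = enc ` (F \<union> sym_diff Y ` F)"
proof -
  have "span (insert (enc Y) S) = subspace_sum (span {enc Y}) (span S)"
    using span_union_is_sum[of "{enc Y}" S] assms by auto
  also have "\<dots> = (\<lambda>y. enc {} \<oplus>\<^bsub>P\<^esub> enc y) ` F \<union> (\<lambda>y. enc Y \<oplus>\<^bsub>P\<^esub> enc y) ` F"
    unfolding span_single[OF assms(1)] assms(4) submodule_sum_def by (auto 4 4)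
  also have "\<dots> = enc ` F \<union> (\<lambda>y. enc (sym_diff Y y)) ` F"
    using assms(1,2) by (intro arg_cong2[of _ _ _ _ "(\<union>)"] image_cong) auto
  finally show ?thesis by (auto simp: image_Un image_image)
qed

text \<open>\<open>F A\<close> stands for the span of the vectors \<open>v i\<close> with
  \<open>i \<in> A\<close>, and \<open>\<rho> A\<close> for its dimension. The hypotheses are the
  recursions that \<open>span_insert_enc\<close> and \<open>rk_insert\<close> prove for the true
  span and rank, so checking them identifies both.\<close>

lemma sum_dim_lines:
  fixes v :: "nat \<Rightarrow> nat set" and \<rho> :: "nat set \<Rightarrow> nat"
  assumes v: "\<And>i. v i \<subseteq> X"
    and F0: "F {} = {{}}" and \<rho>0: "\<rho> {} = 0"
    and F: "\<And>A i. finite A \<Longrightarrow> i \<notin> A \<Longrightarrow> F (insert i A) = F A \<union> sym_diff (v i) ` F A"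
    and \<rho>: "\<And>A i. finite A \<Longrightarrow> i \<notin> A \<Longrightarrow> \<rho> (insert i A) = \<rho> A + (if v i \<in> F A then 0 else 1)"
    and A: "finite A"
  shows "sum_dim K2 P (\<lambda>i. span {enc (v i)}) A = \<rho> A"
proof -
  have *: "F A \<subseteq> Pow X \<and> span ((\<lambda>i. enc (v i)) ` A) = enc ` F A
      \<and> rk ((\<lambda>i. enc (v i)) ` A) = \<rho> A"
    using A
  proof (induction A rule: finite_induct)
    case empty
    then show ?case using span_empty rk_empty by (simp add: F0 \<rho>0)
  next
    case (insert i A)
    let ?S = "(\<lambda>i. enc (v i)) ` A"
    have S: "insert (enc (v i)) ?S \<subseteq> carrier P" using v by auto
    have IH: "F A \<subseteq> Pow X" "span ?S = enc ` F A" "rk ?S = \<rho> A" using insert by auto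
    have "enc (v i) \<in> enc ` F A \<longleftrightarrow> v i \<in> F A"
      using IH v enc_eq_iff by (metis PowD image_iff in_mono)
    then have "rk (insert (enc (v i)) ?S) = \<rho> (insert i A)"
      using rk_insert[of ?S "enc (v i)"] S insert.hyps IH \<rho>[of A i] by simp
    moreover have "span (insert (enc (v i)) ?S) = enc ` F (insert i A)"
      using span_insert_enc[of "v i" "F A" ?S] v S IH F[of A i] insert.hyps by simp
    moreover have "F (insert i A) \<subseteq> Pow X"
    proof -
      have "sym_diff (v i) Y \<subseteq> X" if "Y \<in> F A" for Y using that IH(1) v by blast
      then show ?thesis using F[of A i] insert.hyps IH(1) by auto
    qed
    ultimately show ?case by simp
  qed
  have "family_sum P (\<lambda>i. span {enc (v i)}) A = span ((\<lambda>i. enc (v i)) ` A)"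
    using family_sum_span[of A "\<lambda>i. {enc (v i)}"] A v by (auto simp: UNION_singleton_eq_range)
  then show ?thesis
    unfolding sum_dim_def using conjunct2[OF conjunct2[OF *]] by (rule ssubst)
qed

end

lemma binary_rank_function:
  fixes v :: "nat \<Rightarrow> nat set" and \<rho> :: "nat set \<Rightarrow> nat"
  assumes X: "finite X" and v: "\<And>i. v i \<subseteq> X"
    and F: "F {} = {{}}" "\<rho> {} = 0"
      "\<And>A i. finite A \<Longrightarrow> i \<notin> A \<Longrightarrow> F (insert i A) = F A \<union> sym_diff (v i) ` F A"
      "\<And>A i. finite A \<Longrightarrow> i \<notin> A \<Longrightarrow> \<rho> (insert i A) = \<rho> A + (if v i \<in> F A then 0 else 1)"
  shows "(\<lambda>A. if A \<subseteq> {1..n} then real (\<rho> A) else 0)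
    \<in> rank_functions TYPE('k::infinite) TYPE('v::infinite) n"
proof -
  have finite_A: "finite A" if "A \<subseteq> {1..n}" for A
    using that finite_subset by blast
  obtain z u :: 'k where zu: "z \<noteq> u"
    using ex_new_if_finite[of "{undefined :: 'k}"] infinite_UNIV by auto
  \<comment> \<open>Infinity of \<open>'v\<close> provides room for a copy of the finite space
    \<open>Pow X\<close>.\<close>
  obtain B :: "'v set" where B: "finite B" "card B = card (Pow X)"
    using infinite_arbitrarily_large[of "UNIV :: 'v set" "card (Pow X)"] infinite_UNIV by blast
  then obtain enc where "bij_betw enc (Pow X) B"
    using finite_same_card_bij[of "Pow X" B] X by auto
  then interpret encoded_pow_space z u enc X
    using zu X by unfold_locales (auto simp: bij_betw_def)
  let ?W = "\<lambda>i. span {enc (v i)}"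
  have "subspace_arrangement K2 P n ?W"
    using v by (auto simp: subspace_arrangement_def vectorspace_P fin_dim_P intro!: span_is_subspace)
  moreover have "sum_dim K2 P ?W A = \<rho> A" if "A \<subseteq> {1..n}" for A
    using v F finite_A[OF that] by (rule sum_dim_lines)
  then have "rank_function K2 P n ?W = (\<lambda>A. if A \<subseteq> {1..n} then real (\<rho> A) else 0)"
    unfolding rank_function_def by auto
  ultimately show ?thesis
    unfolding rank_functions_def mem_Collect_eq
    by (intro exI[of _ K2] exI[of _ P] exI[of _ ?W]) simp
qed

definition meets :: "nat \<Rightarrow> nat set \<Rightarrow> nat set \<Rightarrow> real" where
  "meets n S A = of_bool (A \<subseteq> {1..n} \<and> A \<inter> S \<noteq> {})"

text \<open>For \<open>T\<close> within \<open>{1..n}\<close> of size at least 2, the rank function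
  of the matroid in which \<open>T\<close> is a circuit and all other indices are loops.\<close>

definition circuit :: "nat \<Rightarrow> nat set \<Rightarrow> nat set \<Rightarrow> real" where
  "circuit n T A = (if A \<subseteq> {1..n} then real (card (A \<inter> T)) - of_bool (T \<subseteq> A) else 0)"

text \<open>One line, repeated at the indices in \<open>S\<close>.\<close>

lemma meets_in_rank_functions:
  "meets n S \<in> rank_functions TYPE('k::infinite) TYPE('v::infinite) n"
proof -
  let ?v = "\<lambda>i. if i \<in> S then {0} else {}"
  let ?F = "\<lambda>A. if A \<inter> S = {} then {{}} else {{}, {0}}"
  let ?\<rho> = "\<lambda>A. if A \<inter> S = {} then 0 else 1"
  have "(\<lambda>A. if A \<subseteq> {1..n} then real (?\<rho> A) else 0)
      \<in> rank_functions TYPE('k::infinite) TYPE('v::infinite) n"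
    by (rule binary_rank_function[where X = "{0}" and v = ?v and F = ?F]) auto
  then show ?thesis by (rule back_subst[where P = "\<lambda>f. f \<in> _"]) (auto simp: meets_def)
qed

text \<open>Linearly independent vectors together with their sum, the latter at the index \<open>t\<close>.\<close>

lemma circuit_in_rank_functions:
  assumes T: "finite T" "card T \<ge> 2"
  shows "circuit n T \<in> rank_functions TYPE('k::infinite) TYPE('v::infinite) n"
proof -
  obtain t where t: "t \<in> T" using T by fastforce
  define T' where "T' = T - {t}"
  have T': "finite T'" "t \<notin> T'" "T = insert t T'" using T t by (auto simp: T'_def)
  have ne: "T' \<noteq> {}" using T T' by auto
  let ?v = "\<lambda>i. if i = t then T' else {i} \<inter> T'"
  \<comment> \<open>The span of the vectors at \<open>A\<close>: sets supported in \<open>A\<close>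
    and, once the vector \<open>T'\<close> at \<open>t\<close> is available, also their complements
    in \<open>T'\<close>.\<close>
  let ?F = "\<lambda>A. {Y. Y \<subseteq> T' \<and> (Y \<subseteq> A \<or> t \<in> A \<and> T' - A \<subseteq> Y)}"
  let ?\<rho> = "\<lambda>A. card (A \<inter> T) - (if T \<subseteq> A then 1 else 0)"
  \<comment> \<open>Keeps the natural subtraction in \<open>?\<rho>\<close> from truncating when it
    is compared with the real one in \<open>circuit\<close>.\<close>
  have pos: "card (A \<inter> T) \<ge> 1" if "T \<subseteq> A" for A
    using that T by (simp add: Int_absorb1)
  have "(\<lambda>A. if A \<subseteq> {1..n} then real (?\<rho> A) else 0)
      \<in> rank_functions TYPE('k::infinite) TYPE('v::infinite) n"
  proof (rule binary_rank_function[where X = T' and v = ?v and F = ?F])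
    fix A :: "nat set" and i assume A: "finite A" "i \<notin> A"
    have inv: "Y = sym_diff D (sym_diff D Y)" for D Y :: "nat set" by blast
    show "?F (insert i A) = ?F A \<union> sym_diff (?v i) ` ?F A"
    proof (rule Set.set_eqI)
      fix Y
      have "Y \<in> sym_diff (?v i) ` ?F A \<longleftrightarrow> sym_diff (?v i) Y \<in> ?F A"
        using inv[of _ "?v i"] by (metis (no_types, lifting) image_iff)
      moreover have "Y \<in> ?F (insert i A) \<longleftrightarrow> Y \<in> ?F A \<or> sym_diff (?v i) Y \<in> ?F A"
      proof -
        consider "i = t" | "i \<noteq> t" "i \<in> T'" | "i \<noteq> t" "i \<notin> T'" by blast
        then show ?thesis
        proof cases
          case 1
          then show ?thesis using A T' by simp blast
        next
          case 2
          then show ?thesis using A T' by simp blast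
        next
          case 3
          then show ?thesis using A T' by simp blast
        qed
      qed
      ultimately show "Y \<in> ?F (insert i A) \<longleftrightarrow> Y \<in> ?F A \<union> sym_diff (?v i) ` ?F A"
        by (simp only: Un_iff)
    qed
    show "?\<rho> (insert i A) = ?\<rho> A + (if ?v i \<in> ?F A then 0 else 1)"
    proof (cases "i \<in> T")
      case False
      then have "insert i A \<inter> T = A \<inter> T" "T \<subseteq> insert i A \<longleftrightarrow> T \<subseteq> A" by auto
      moreover have "?v i = {}" using False T' by auto
      ultimately show ?thesis by simp
    next
      case True
      then have "card (insert i A \<inter> T) = Suc (card (A \<inter> T))" "\<not> T \<subseteq> A"
        using A T by auto
      moreover have "?v i \<in> ?F A \<longleftrightarrow> T \<subseteq> insert i A"
        using A T' True by auto
      ultimately show ?thesis by simp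
    qed
  qed (use T' ne in auto)
  then show ?thesis
    by (rule back_subst[where P = "\<lambda>f. f \<in> _"])
      (use pos in \<open>auto simp: circuit_def of_nat_diff\<close>)
qed

section \<open>The functional on the basis of up-set indicators\<close>

lemma H_dual_closed:
  assumes "f \<in> H_dual n"
  shows "dual_scale n c f \<in> H_dual n" "g \<in> H_dual n \<Longrightarrow> dual_add n f g \<in> H_dual n"
  using assms by (auto simp: H_dual_def dual_scale_def dual_add_def H_space_closed algebra_simps)

lemma H_dual_add:
  "f \<in> H_dual n \<Longrightarrow> F \<in> H_space n \<Longrightarrow> G \<in> H_space n \<Longrightarrow> f (\<lambda>A. F A + G A) = f F + f G"
  by (simp add: H_dual_def)

lemma H_dual_scale:
  "f \<in> H_dual n \<Longrightarrow> F \<in> H_space n \<Longrightarrow> f (\<lambda>A. c * F A) = c * f F"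
  by (simp add: H_dual_def)

lemma I_functional_in_H_dual: "I_functional n \<in> H_dual n"
  by (auto simp: H_dual_def I_functional_def H_space_closed algebra_simps sum.distrib
      sum_distrib_left)

text \<open>Regrouped so that index \<open>i\<close> contributes the single term
  \<open>I(2;i-1|i)\<close>, which can be evaluated on its own.\<close>

lemma I_functional_eq:
  assumes "F \<in> H_space n"
  shows "I_functional n F = F {1, 3} + F {1, n} + F {2, 3} - F {1, 2} - F {1, 3, n} - F {3}
    + (\<Sum>i=4..n. F {2, i} + F {i - 1, i} - F {i} - F {2, i - 1, i})"
  using assms by (simp add: I_functional_def sum.distrib sum_subtractf)

text \<open>These serve as coordinates only: for \<open>T \<subseteq> {1..n}\<close> with two or
  more elements the singletons get value 0 but \<open>T\<close> gets 1, so this is not a rank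
  function.\<close>

definition above :: "nat \<Rightarrow> nat set \<Rightarrow> nat set \<Rightarrow> real" where
  "above n T A = of_bool (A \<subseteq> {1..n} \<and> T \<subseteq> A)"

lemma meets_in_H_space: "meets n S \<in> H_space n"
  by (simp add: H_space_def meets_def)

lemma above_in_H_space: "T \<noteq> {} \<Longrightarrow> above n T \<in> H_space n"
  by (simp add: H_space_def above_def)

lemma above_single: "above n {i} = meets n {i}"
  by (auto simp: above_def meets_def fun_eq_iff)

section \<open>Values of the functional on rank-one functions\<close>

lemma I_functional_meets_without_2:
  assumes "n \<ge> 4" "2 \<notin> S"
  shows "I_functional n (meets n S) = of_bool (1 \<in> S \<or> 3 \<in> S) + of_bool (1 \<in> S \<or> n \<in> S)
    - of_bool (1 \<in> S) - of_bool (1 \<in> S \<or> 3 \<in> S \<or> n \<in> S)"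
proof -
  have "(\<Sum>i=4..n. meets n S {2, i} + meets n S {i - 1, i} - meets n S {i} - meets n S {2, i - 1, i})
      = 0"
    using assms by (intro sum.neutral ballI) (auto simp: meets_def)
  then show ?thesis
    using assms by (subst I_functional_eq[OF meets_in_H_space]) (auto simp: meets_def)
qed

text \<open>The sum counts the places where membership in \<open>S\<close> is lost when walking from
  3 up to \<open>n\<close>. Intervals have at most one such place, which makes them the natural
  tight sets.\<close>

lemma I_functional_meets_with_2:
  assumes "n \<ge> 4" "2 \<in> S"
  shows "I_functional n (meets n S) = of_bool (1 \<in> S \<or> 3 \<in> S) + of_bool (1 \<in> S \<or> n \<in> S)
    - of_bool (3 \<in> S) - of_bool (1 \<in> S \<or> 3 \<in> S \<or> n \<in> S)
    + (\<Sum>i=4..n. of_bool (i - 1 \<in> S \<and> i \<notin> S))"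
proof -
  have "(\<Sum>i=4..n. meets n S {2, i} + meets n S {i - 1, i} - meets n S {i} - meets n S {2, i - 1, i})
      = (\<Sum>i=4..n. of_bool (i - 1 \<in> S \<and> i \<notin> S))"
    using assms by (intro sum.cong refl) (auto simp: meets_def)
  then show ?thesis
    using assms by (subst I_functional_eq[OF meets_in_H_space]) (auto simp: meets_def)
qed

lemma I_functional_meets_12: "n \<ge> 4 \<Longrightarrow> I_functional n (meets n {1, 2}) = 1"
  by (subst I_functional_meets_with_2) (auto intro!: sum.neutral)

lemma I_functional_meets_single: "n \<ge> 4 \<Longrightarrow> I_functional n (meets n {i}) = 0"
  by (cases "i = 2")
    (auto simp: I_functional_meets_with_2 I_functional_meets_without_2 intro!: sum.neutral)

lemma I_functional_meets_final:
  assumes "n \<ge> 4" "4 \<le> j"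
  shows "I_functional n (meets n (insert 2 {j..n})) = 0"
proof -
  have "(\<Sum>i=4..n. of_bool (i - 1 \<in> insert 2 {j..n} \<and> i \<notin> insert 2 {j..n})) = (0 :: real)"
    using assms by (intro sum.neutral) auto
  then show ?thesis
    using assms by (subst I_functional_meets_with_2) auto
qed

lemma I_functional_meets_initial:
  assumes "n \<ge> 4" "3 \<le> j" "j \<le> n"
  shows "I_functional n (meets n {2..j}) = 0"
proof -
  have "(\<Sum>i=4..n. of_bool (i - 1 \<in> {2..j} \<and> i \<notin> {2..j}))
      = (\<Sum>i=4..n. if i = Suc j then 1 else (0 :: real))"
    using assms by (intro sum.cong) auto
  \<comment> \<open>The interval is left after \<open>j\<close> only if \<open>j < n\<close>; this 1
    is cancelled by the boundary terms, which add up to -1 exactly when \<open>n\<close> is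
    missing.\<close>
  also have "\<dots> = of_bool (j < n)" using assms by (simp add: Suc_le_eq)
  finally show ?thesis
    using assms by (subst I_functional_meets_with_2) auto
qed

lemma I_functional_meets_all:
  assumes "n \<ge> 4"
  shows "I_functional n (meets n {1..n}) = 0"
proof -
  have "(\<Sum>i=4..n. of_bool (i - 1 \<in> {1..n} \<and> i \<notin> {1..n})) = (0 :: real)"
    by (intro sum.neutral) auto
  then show ?thesis
    using assms by (subst I_functional_meets_with_2) auto
qed

section \<open>Values of the functional on up-set indicators\<close>

lemma subset_pair_iff:
  assumes "card T \<ge> 2"
  shows "T \<subseteq> {a, b} \<longleftrightarrow> T = {a, b} \<and> a \<noteq> b"
proof
  assume T: "T \<subseteq> {a, b}"
  then have "card T \<le> card {a, b}" by (intro card_mono) auto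
  then have "a \<noteq> b" using assms by (auto split: if_splits)
  then show "T = {a, b} \<and> a \<noteq> b" using card_seteq[of "{a, b}" T] T assms by auto
qed auto

lemma subset_triple_iff:
  assumes "card T \<ge> 2" "a \<noteq> b" "a \<noteq> c" "b \<noteq> c"
  shows "T \<subseteq> {a, b, c} \<longleftrightarrow> T = {a, b, c} \<or> T = {a, b} \<or> T = {a, c} \<or> T = {b, c}"
proof
  assume T: "T \<subseteq> {a, b, c}"
  show "T = {a, b, c} \<or> T = {a, b} \<or> T = {a, c} \<or> T = {b, c}"
  proof (cases "T = {a, b, c}")
    case False
    then have "T \<subseteq> {a, b} \<or> T \<subseteq> {a, c} \<or> T \<subseteq> {b, c}" using T by blast
    then show ?thesis using assms by (auto simp: subset_pair_iff)
  qed simp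
qed auto

text \<open>The sets \<open>T\<close> of size at least 2 with \<open>I_functional n (above n T) \<noteq> 0\<close>.\<close>

definition special :: "nat \<Rightarrow> nat set \<Rightarrow> bool" where
  "special n T \<longleftrightarrow> T = {1, 2} \<or> T = {3, n} \<or> T = {1, 3, n} \<or>
     (\<exists>i\<in>{4..<n}. T = {2, i}) \<or> (\<exists>i\<in>{4..n}. T = {2, i - 1, i})"

text \<open>The triples are reindexed as \<open>{2, i, Suc i}\<close>, which spares the later case
  analyses the subtraction on naturals.\<close>

lemma special_cases:
  assumes "special n T"
  obtains "T = {1, 2}" | "T = {3, n}" | "T = {1, 3, n}"
    | i where "4 \<le> i" "i < n" "T = {2, i}" | i where "3 \<le> i" "i < n" "T = {2, i, Suc i}"
  using assms unfolding special_def
proof (elim disjE bexE)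
  fix i assume "i \<in> {4..<n}" "T = {2, i}"
  then show thesis by (intro that(4)[of i]) auto
next
  fix i assume "i \<in> {4..n}" "T = {2, i - 1, i}"
  then show thesis by (intro that(5)[of "i - 1"]) auto
qed (use that(1-3) in blast)+

text \<open>Pairs cancel against the triples that contain them: \<open>{2, i}\<close> and
  \<open>{i - 1, i}\<close> inside each summand, \<open>{1, 3}\<close> and \<open>{1, n}\<close>
  against \<open>{1, 3, n}\<close>. What is left of the sum is the contribution of
  \<open>{2, 3}\<close> at \<open>i = 4\<close>, cancelled by the term
  \<open>F {2, 3}\<close>.\<close>

lemma I_functional_above_nonspecial:
  assumes n: "n \<ge> 4" and T: "T \<subseteq> {1..n}" "card T \<ge> 2" "\<not> special n T"
  shows "I_functional n (above n T) = 0"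
proof -
  have T0: "T \<noteq> {}" and T1: "\<not> T \<subseteq> {i}" for i
    using T subset_pair_iff[of T i i] by auto
  have v1: "above n T {a} = 0" for a
    using T1 by (simp add: above_def)
  have v2: "above n T {a, b} = of_bool (T = {a, b})" if "a \<in> {1..n}" "b \<in> {1..n}" "a \<noteq> b" for a b
    using that subset_pair_iff[OF T(2), of a b] by (simp add: above_def)
  have v3: "above n T {a, b, c} = of_bool (T = {a, b, c} \<or> T = {a, b} \<or> T = {a, c} \<or> T = {b, c})"
    if "a \<in> {1..n}" "b \<in> {1..n}" "c \<in> {1..n}" "a \<noteq> b" "a \<noteq> c" "b \<noteq> c" for a b c
    using that subset_triple_iff[OF T(2), of a b c] by (simp add: above_def)
  have "(\<Sum>i=4..n. above n T {2, i} + above n T {i - 1, i} - above n T {i} - above n T {2, i - 1, i})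
      = (\<Sum>i=4..n. if i = 4 then - of_bool (T = {2, 3}) else 0)"
  proof (intro sum.cong refl)
    fix i assume i: "i \<in> {4..n}"
    have "above n T {2, i} = of_bool (T = {2, i})" using i by (intro v2) auto
    moreover have "above n T {i - 1, i} = of_bool (T = {i - 1, i})" using i by (intro v2) auto
    moreover have "above n T {2, i - 1, i}
        = of_bool (T = {2, i - 1, i} \<or> T = {2, i - 1} \<or> T = {2, i} \<or> T = {i - 1, i})"
      using i by (intro v3) auto
    ultimately have "above n T {2, i} + above n T {i - 1, i} - above n T {i} - above n T {2, i - 1, i}
        = of_bool (T = {2, i}) + of_bool (T = {i - 1, i})
          - of_bool (T = {2, i - 1, i} \<or> T = {2, i - 1} \<or> T = {2, i} \<or> T = {i - 1, i})"
      by (simp only: v1 diff_0_right)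
    also have "\<dots> = - of_bool (T = {2, i - 1, i} \<or> T = {2, i - 1})"
    proof -
      have "i - 1 \<notin> {2, i}" "2 \<notin> {i - 1, i}" "i \<notin> {2, i - 1}" using i by auto
      then have "{2, i} \<noteq> {i - 1, i}" "{2, i - 1, i} \<noteq> {2, i}" "{2, i - 1, i} \<noteq> {i - 1, i}"
        "{2, i - 1} \<noteq> {2, i}" "{2, i - 1} \<noteq> {i - 1, i}"
        by blast+
      then show ?thesis by auto
    qed
    also have "\<dots> = (if i = 4 then - of_bool (T = {2, 3}) else 0)"
    proof -
      have "T \<noteq> {2, i - 1, i}" using T(3) i by (auto simp: special_def)
      \<comment> \<open>For \<open>i > 4\<close> this pair is special; for \<open>i = 4\<close> it
        is \<open>{2, 3}\<close>, which is not.\<close>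
      moreover have "T \<noteq> {2, i - 1}" if "i \<noteq> 4"
      proof -
        have "i - 1 \<in> {4..<n}" using i that by auto
        then show ?thesis using T(3) by (auto simp: special_def)
      qed
      ultimately show ?thesis by auto
    qed
    finally show "above n T {2, i} + above n T {i - 1, i} - above n T {i} - above n T {2, i - 1, i}
        = (if i = 4 then - of_bool (T = {2, 3}) else 0)" .
  qed
  also have "\<dots> = - of_bool (T = {2, 3})" using n by simp
  finally have sum: "(\<Sum>i=4..n. above n T {2, i} + above n T {i - 1, i} - above n T {i}
      - above n T {2, i - 1, i}) = - of_bool (T = {2, 3})" .
  have "above n T {1, 3} + above n T {1, n} - above n T {1, 2} - above n T {1, 3, n}
      = of_bool (T = {1, 3}) + of_bool (T = {1, n}) - of_bool (T = {1, 3} \<or> T = {1, n})"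
  proof -
    have "above n T {1, 3} = of_bool (T = {1, 3})" using n by (intro v2) auto
    moreover have "above n T {1, n} = of_bool (T = {1, n})" using n by (intro v2) auto
    moreover have "above n T {1, 2} = of_bool (T = {1, 2})" using n by (intro v2) auto
    moreover have "above n T {1, 3, n}
        = of_bool (T = {1, 3, n} \<or> T = {1, 3} \<or> T = {1, n} \<or> T = {3, n})"
      using n by (intro v3) auto
    moreover have "T \<noteq> {1, 2}" "T \<noteq> {1, 3, n}" "T \<noteq> {3, n}"
      using T(3) unfolding special_def by blast+
    ultimately show ?thesis by (simp only: simp_thms of_bool_eq diff_0_right)
  qed
  also have "\<dots> = 0" using n by (auto simp: doubleton_eq_iff)
  finally show ?thesis
    using n sum v1[of 3] v2[of 2 3]
    by (subst I_functional_eq[OF above_in_H_space[OF T0]]) simp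
qed

section \<open>Functionals vanishing on the tight rank functions\<close>

lemma circuit_eq_above:
  assumes T: "T \<subseteq> {1..n}"
  shows "circuit n T = (\<lambda>A. (\<Sum>i\<in>T. 1 * above n {i} A) + (-1) * above n T A)"
proof
  fix A
  have "finite T" using T finite_subset by blast
  then show "circuit n T A = (\<Sum>i\<in>T. 1 * above n {i} A) + (-1) * above n T A"
    by (auto simp: circuit_def above_def of_bool_def Int_commute sum.If_cases)
qed

lemma H_dual_circuit:
  assumes f: "f \<in> H_dual n" and T: "T \<subseteq> {1..n}" "T \<noteq> {}"
  shows "f (circuit n T) = (\<Sum>i\<in>T. f (above n {i})) - f (above n T)"
proof -
  have "finite T" using T finite_subset by blast
  then have s: "(\<lambda>A. \<Sum>i\<in>T. 1 * above n {i} A) \<in> H_space n"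
    "f (\<lambda>A. \<Sum>i\<in>T. 1 * above n {i} A) = (\<Sum>i\<in>T. 1 * f (above n {i}))"
    using H_dual_sum[OF f, of T "\<lambda>i. above n {i}" "\<lambda>_. 1"] above_in_H_space by auto
  note a = above_in_H_space[OF T(2), of n]
  show ?thesis
    unfolding circuit_eq_above[OF T(1)]
    using H_dual_add[OF f s(1) H_space_closed(2)[OF a, of "-1"]] s(2) H_dual_scale[OF f a, of "-1"]
    by simp
qed

text \<open>Inclusion-exclusion, obtained by multiplying out the product of
  \<open>1 - of_bool (x \<in> A)\<close> over \<open>x \<in> S\<close>.\<close>

lemma sum_subsets_alternating:
  assumes "finite S"
  shows "(\<Sum>U\<in>Pow S. (-1) ^ card U * of_bool (U \<subseteq> A)) = (of_bool (S \<inter> A = {}) :: real)"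
proof -
  have p: "(\<Prod>x\<in>U. of_bool (x \<in> A)) = (of_bool (U \<subseteq> A) :: real)" if "U \<subseteq> S" for U
    using finite_subset[OF that assms] by (induction U rule: finite_induct) auto
  have "(\<Sum>U\<in>Pow S. (-1) ^ card U * of_bool (U \<subseteq> A)) = (\<Prod>x\<in>S. (1 :: real) - of_bool (x \<in> A))"
    using p by (subst prod_diff_conv_sum[OF assms]) (auto intro!: sum.cong)
  also have "\<dots> = of_bool (S \<inter> A = {})"
    using assms by (induction S rule: finite_induct) auto
  finally show ?thesis .
qed

text \<open>\<open>meets n (insert j S)\<close> exceeds \<open>meets n S\<close> exactly on the sets
  that contain \<open>j\<close> and avoid \<open>S\<close>; inclusion-exclusion expands the
  indicator of these.\<close>

lemma H_dual_meets_insert: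
  assumes f: "f \<in> H_dual n" and S: "finite S" "j \<notin> S"
  shows "f (meets n (insert j S))
    = f (meets n S) + (\<Sum>U\<in>Pow S. (-1) ^ card U * f (above n (insert j U)))"
proof -
  let ?R = "\<lambda>A. \<Sum>U\<in>Pow S. (-1) ^ card U * above n (insert j U) A"
  have "meets n (insert j S) = (\<lambda>A. meets n S A + ?R A)"
  proof
    fix A
    have "?R A = of_bool (A \<subseteq> {1..n} \<and> j \<in> A) * (\<Sum>U\<in>Pow S. (-1) ^ card U * of_bool (U \<subseteq> A))"
      unfolding sum_distrib_left by (intro sum.cong refl) (simp add: above_def)
    then show "meets n (insert j S) A = meets n S A + ?R A"
      unfolding sum_subsets_alternating[OF S(1)] by (auto simp: meets_def)
  qed
  moreover have "?R \<in> H_space n \<and> f ?R = (\<Sum>U\<in>Pow S. (-1) ^ card U * f (above n (insert j U)))"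
    by (rule H_dual_sum[OF f]) (auto simp: S above_in_H_space)
  ultimately show ?thesis using H_dual_add[OF f meets_in_H_space] by simp
qed

text \<open>\<open>above n T\<close> is the sum of \<open>unit_fun A\<close> over the supersets
  \<open>A\<close> of \<open>T\<close>. This triangular system is solved from the full set
  downwards.\<close>

lemma H_dual_eq_0_above:
  assumes f: "f \<in> H_dual n"
    and above: "\<And>T. T \<subseteq> {1..n} \<Longrightarrow> T \<noteq> {} \<Longrightarrow> f (above n T) = 0"
    and F: "F \<in> H_space n"
  shows "f F = 0"
proof -
  have "T \<subseteq> {1..n} \<Longrightarrow> T \<noteq> {} \<Longrightarrow> f (unit_fun T) = 0" for T
  proof (induction "n - card T" arbitrary: T rule: less_induct)
    case less
    let ?U = "{A. T \<subseteq> A \<and> A \<subseteq> {1..n}}"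
    have fin: "finite ?U" by (rule finite_subset[of _ "Pow {1..n}"]) auto
    have smaller: "f (unit_fun A) = 0" if "A \<in> ?U - {T}" for A
    proof (rule less(1))
      have A: "T \<subset> A" "A \<subseteq> {1..n}" using that by auto
      then have "card T < card A" using finite_subset[OF A(2)] by (intro psubset_card_mono) auto
      moreover have "card A \<le> n" using card_mono[OF _ A(2)] by simp
      ultimately show "n - card A < n - card T" by simp
      show "A \<subseteq> {1..n}" "A \<noteq> {}" using A less by auto
    qed
    have "above n T = (\<lambda>B. \<Sum>A\<in>?U. 1 * unit_fun A B)"
    proof
      fix B
      have "(\<Sum>A\<in>?U. 1 * unit_fun A B) = (\<Sum>A\<in>?U. if A = B then 1 else 0)"
        by (intro sum.cong) (auto simp: unit_fun_def)
      then show "above n T B = (\<Sum>A\<in>?U. 1 * unit_fun A B)"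
        using fin by (auto simp: above_def)
    qed
    moreover have "unit_fun A \<in> H_space n" if "A \<in> ?U" for A
      using that less by (intro unit_fun_in_H_space) auto
    ultimately have "f (above n T) = (\<Sum>A\<in>?U. 1 * f (unit_fun A))"
      using H_dual_sum[OF f fin, of unit_fun "\<lambda>_. 1"] by simp
    also have "\<dots> = f (unit_fun T)"
      using sum.remove[OF fin, of T "\<lambda>A. 1 * f (unit_fun A)"] less smaller by simp
    finally show ?case using above less by simp
  qed
  then show ?thesis using H_dual_expand[OF f F] by simp
qed

text \<open>Only two families of tight rank functions enter. The last assumption removes the
  multiples of \<open>I_functional n\<close>, whose value on \<open>meets n {1, 2}\<close> is
  1.\<close>

locale vanishing_functional =
  fixes n :: nat and g :: "(nat set \<Rightarrow> real) \<Rightarrow> real"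
  assumes n: "n \<ge> 4" and g: "g \<in> H_dual n"
    and meets_tight: "I_functional n (meets n S) = 0 \<Longrightarrow> g (meets n S) = 0"
    and circuit_tight: "card T \<ge> 2 \<Longrightarrow> I_functional n (circuit n T) = 0 \<Longrightarrow> g (circuit n T) = 0"
    and normalized: "g (meets n {1, 2}) = 0"
begin

lemma g_single: "g (above n {i}) = 0"
  using meets_tight[OF I_functional_meets_single[OF n]] by (simp add: above_single)

text \<open>\<open>I_functional n\<close> vanishes at \<open>T\<close> and at all singletons, so the
  circuit on \<open>T\<close> is tight; \<open>g\<close> then vanishes on it, and its singleton
  terms vanish too.\<close>

lemma g_nonspecial:
  assumes "T \<subseteq> {1..n}" "T \<noteq> {}" "\<not> special n T"
  shows "g (above n T) = 0"
proof (cases "card T \<ge> 2")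
  case True
  note c = H_dual_circuit[OF _ assms(1,2)]
  have "I_functional n (above n {i}) = 0" for i
    using I_functional_meets_single[OF n] by (simp add: above_single)
  then have "g (circuit n T) = 0"
    using c[OF I_functional_in_H_dual] I_functional_above_nonspecial[OF n assms(1) True assms(3)]
    by (intro circuit_tight[OF True]) simp
  then show ?thesis using c[OF g] g_single by simp
next
  case False
  have "finite T" using assms finite_subset by blast
  then have "card T = 1" using False assms(2) by (simp add: not_le less_2_cases_iff)
  then show ?thesis using g_single by (auto simp: card_1_singleton_iff)
qed

text \<open>The expansion of \<open>meets n (insert j S)\<close> over \<open>meets n S\<close> must
  give 0. Only \<open>T1\<close> and \<open>T2\<close> survive in it, and with \<open>j\<close>
  removed they have sizes 1 and 2, hence opposite signs.\<close>

lemma g_swap: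
  assumes tight: "I_functional n (meets n S) = 0" "I_functional n (meets n (insert j S)) = 0"
    and S: "insert j S \<subseteq> {1..n}" "j \<notin> S"
    and T: "T1 \<subseteq> insert j S" "T2 \<subseteq> insert j S" "j \<in> T1" "j \<in> T2" "card T1 = 2" "card T2 = 3"
    and special: "\<And>T. special n T \<Longrightarrow> T \<subseteq> insert j S \<Longrightarrow> j \<in> T \<Longrightarrow> T = T1 \<or> T = T2"
  shows "g (above n T1) = g (above n T2)"
proof -
  have fin: "finite S" using S finite_subset[of S "{1..n}"] by simp
  let ?h = "\<lambda>U. (-1) ^ card U * g (above n (insert j U))"
  have "(\<Sum>U\<in>Pow S. ?h U) = 0"
    using H_dual_meets_insert[OF g fin S(2)] meets_tight tight by simp
  moreover have "(\<Sum>U\<in>Pow S. ?h U) = (\<Sum>U\<in>{T1 - {j}, T2 - {j}}. ?h U)"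
  proof (rule sum.mono_neutral_right)
    show "{T1 - {j}, T2 - {j}} \<subseteq> Pow S" using T by auto
    show "\<forall>U\<in>Pow S - {T1 - {j}, T2 - {j}}. ?h U = 0"
    proof
      fix U assume U: "U \<in> Pow S - {T1 - {j}, T2 - {j}}"
      then have "insert j U \<noteq> T1" "insert j U \<noteq> T2" using S by auto
      then have "\<not> special n (insert j U)" using special[of "insert j U"] U by auto
      then have "g (above n (insert j U)) = 0" using g_nonspecial[of "insert j U"] U S by auto
      then show "?h U = 0" by simp
    qed
  qed (use fin in simp)
  moreover have "T1 - {j} \<noteq> T2 - {j}" using T by (metis insert_Diff numeral_eq_iff semiring_norm(89))
  moreover have "card (T1 - {j}) = 1" "card (T2 - {j}) = 2" using T by auto
  moreover have "insert j T1 = T1" "insert j T2 = T2" using T by auto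
  ultimately show ?thesis by simp
qed

section \<open>Following the chain of special sets\<close>

lemma g_12: "g (above n {1, 2}) = 0"
proof -
  have "g (meets n (insert 2 {1})) = g (meets n {1})
      + (\<Sum>U\<in>Pow {1}. (-1) ^ card U * g (above n (insert 2 U)))"
    by (rule H_dual_meets_insert[OF g]) auto
  moreover have "Pow {1 :: nat} = {{}, {1}}" by auto
  ultimately show ?thesis
    using normalized g_single[of 1] g_single[of 2] by (simp add: above_single insert_commute)
qed

text \<open>Inserting 1 into \<open>{2..n}\<close> leads from one tight set to another, and
  \<open>{1, 2}\<close>, \<open>{1, 3, n}\<close> are the only special sets containing 1.\<close>

lemma g_13n: "g (above n {1, 3, n}) = 0"
proof -
  have i: "insert 1 {2..n} = {1..n}" using n by auto
  have "g (above n {1, 2}) = g (above n {1, 3, n})"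
  proof (rule g_swap)
    show "I_functional n (meets n {2..n}) = 0" using n by (intro I_functional_meets_initial) auto
    show "I_functional n (meets n (insert 1 {2..n})) = 0"
      unfolding i using n by (rule I_functional_meets_all)
  next
    fix T assume T: "special n T" "T \<subseteq> insert 1 {2..n}" "1 \<in> T"
    from T(1) show "T = {1, 2} \<or> T = {1, 3, n}"
    proof (cases rule: special_cases)
      case (5 i)
      then show ?thesis using T(2,3) n by auto
    qed (use T(2,3) n in auto)
  qed (use n in auto)
  then show ?thesis using g_12 by simp
qed

lemma g_3n: "g (above n {3, n}) = 0"
proof -
  have "g (above n {3, n}) = g (above n {1, 3, n})"
  proof (rule g_swap[where j = 3])
    show "I_functional n (meets n {1, n}) = 0" "I_functional n (meets n (insert 3 {1, n})) = 0"
      using n by (auto simp: I_functional_meets_without_2)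
  next
    fix T assume T: "special n T" "T \<subseteq> insert 3 {1, n}" "3 \<in> T"
    from T(1) show "T = {3, n} \<or> T = {1, 3, n}"
    proof (cases rule: special_cases)
      case (5 i)
      then show ?thesis using T(2,3) n by auto
    qed (use T(2,3) n in auto)
  qed (use n in auto)
  then show ?thesis using g_13n by simp
qed

lemma g_last: "g (above n {2, n - 1, n}) = 0"
proof -
  have i: "insert n {2..n - 1} = {2..n}" using n by auto
  have "g (above n {3, n}) = g (above n {2, n - 1, n})"
  proof (rule g_swap[where j = n])
    show "I_functional n (meets n {2..n - 1}) = 0"
      using n by (intro I_functional_meets_initial) auto
    show "I_functional n (meets n (insert n {2..n - 1})) = 0"
      unfolding i using n by (intro I_functional_meets_initial) auto
  next
    fix T assume T: "special n T" "T \<subseteq> insert n {2..n - 1}" "n \<in> T"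
    from T(1) show "T = {3, n} \<or> T = {2, n - 1, n}"
    proof (cases rule: special_cases)
      case (5 i)
      then show ?thesis using T(2,3) n by auto
    qed (use T(2,3) n in auto)
  qed (use n in auto)
  then show ?thesis using g_3n by simp
qed

text \<open>Final segments together with 2 link \<open>{2, j}\<close> to the triple above it;
  initial intervals do the same for the triple below in \<open>g_down\<close>.\<close>

lemma g_up:
  assumes j: "4 \<le> j" "j < n"
  shows "g (above n {2, j}) = g (above n {2, j, Suc j})"
proof -
  have i: "insert j (insert 2 {Suc j..n}) = insert 2 {j..n}" using j by auto
  show ?thesis
  proof (rule g_swap[where j = j])
    show "I_functional n (meets n (insert 2 {Suc j..n})) = 0"
      using n j by (intro I_functional_meets_final) auto
    show "I_functional n (meets n (insert j (insert 2 {Suc j..n}))) = 0"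
      unfolding i using n j by (intro I_functional_meets_final) auto
  next
    fix T assume T: "special n T" "T \<subseteq> insert j (insert 2 {Suc j..n})" "j \<in> T"
    from T(1) show "T = {2, j} \<or> T = {2, j, Suc j}"
    proof (cases rule: special_cases)
      case (5 i)
      then show ?thesis using T(2,3) n j by auto
    qed (use T(2,3) n j in auto)
  qed (use n j in auto)
qed

lemma g_down:
  assumes j: "4 \<le> j" "j < n"
  shows "g (above n {2, j}) = g (above n {2, j - 1, j})"
proof -
  have i: "insert j {2..j - 1} = {2..j}" using j by auto
  show ?thesis
  proof (rule g_swap[where j = j])
    show "I_functional n (meets n {2..j - 1}) = 0"
      using n j by (intro I_functional_meets_initial) auto
    show "I_functional n (meets n (insert j {2..j - 1})) = 0"
      unfolding i using n j by (intro I_functional_meets_initial) auto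
  next
    fix T assume T: "special n T" "T \<subseteq> insert j {2..j - 1}" "j \<in> T"
    from T(1) show "T = {2, j} \<or> T = {2, j - 1, j}"
    proof (cases rule: special_cases)
      case (5 i)
      then show ?thesis using T(2,3) n j by auto
    qed (use T(2,3) n j in auto)
  qed (use n j in auto)
qed

text \<open>Downward from \<open>n\<close>: the triple ending in \<open>Suc j\<close> equals the
  pair \<open>{2, j}\<close> under \<open>g\<close>, which equals the triple ending in
  \<open>j\<close>.\<close>

lemma g_triple:
  assumes "4 \<le> i" "i \<le> n"
  shows "g (above n {2, i - 1, i}) = 0"
  using assms(2,1)
proof (induction i rule: inc_induct)
  case base
  show ?case by (rule g_last)
next
  case (step j)
  then show ?case using g_up[of j] g_down[of j] by simp
qed

lemma g_eq_0: "F \<in> H_space n \<Longrightarrow> g F = 0"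
proof (rule H_dual_eq_0_above[OF g])
  fix T assume T: "T \<subseteq> {1..n}" "T \<noteq> {}"
  show "g (above n T) = 0"
  proof (cases "special n T")
    case True
    moreover have "g (above n {2, i}) = 0" if "i \<in> {4..<n}" for i
      using that g_down[of i] g_triple[of i] by simp
    ultimately show ?thesis
      using g_12 g_3n g_13n g_triple unfolding special_def by auto
  qed (use T g_nonspecial in blast)
qed

end

text \<open>Subtracting the right multiple of \<open>I_functional n\<close> makes the value on
  \<open>meets n {1, 2}\<close> zero, and \<open>vanishing_functional\<close> applies to the
  difference.\<close>

lemma tight_functional_eq_scale:
  assumes n: "n \<ge> 4" and f: "f \<in> H_dual n"
    and tight: "\<And>F. F \<in> rank_functions TYPE('k::infinite) TYPE('v::infinite) n \<Longrightarrow> I_functional n F = 0 \<Longrightarrow> f F = 0"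
  shows "f = dual_scale n (f (meets n {1, 2})) (I_functional n)"
proof -
  let ?c = "f (meets n {1, 2})"
  let ?g = "dual_add n f (dual_scale n (- ?c) (I_functional n))"
  have g_apply: "?g F = f F - ?c * I_functional n F" if "F \<in> H_space n" for F
    using that by (simp add: dual_add_def dual_scale_def)
  have gR: "?g F = 0" if "F \<in> rank_functions TYPE('k) TYPE('v) n" "I_functional n F = 0" "F \<in> H_space n" for F
    using tight that g_apply by simp
  interpret vanishing_functional n ?g
  proof
    show "n \<ge> 4" by fact
    show "?g \<in> H_dual n"
      by (intro H_dual_closed f I_functional_in_H_dual)
    show "?g (meets n S) = 0" if "I_functional n (meets n S) = 0" for S
      using that meets_in_rank_functions meets_in_H_space by (intro gR)
    show "?g (meets n {1, 2}) = 0"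
      using g_apply[OF meets_in_H_space] I_functional_meets_12[OF n] by simp
  next
    fix T :: "nat set" assume T: "card T \<ge> 2"
    assume "I_functional n (circuit n T) = 0"
    moreover have "finite T" using T card.infinite by fastforce
    then have "circuit n T \<in> rank_functions TYPE('k) TYPE('v) n" using T by (intro circuit_in_rank_functions)
    moreover have "circuit n T \<in> H_space n" using T by (auto simp: H_space_def circuit_def)
    ultimately show "?g (circuit n T) = 0" by (intro gR)
  qed
  show ?thesis
  proof
    fix F
    show "f F = dual_scale n ?c (I_functional n) F"
    proof (cases "F \<in> H_space n")
      case True
      then show ?thesis using g_apply[OF True] g_eq_0[OF True] by (simp add: dual_scale_def)
    next
      case False
      then show ?thesis using f by (simp add: dual_scale_def H_dual_def extensional_def)
    qed
  qed
qed

section \<open>Nonnegativity on the rank cone\<close>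

lemma subspace_arrangement_iff_locale: "subspace_arrangement K V n W \<longleftrightarrow> arrangement K V n W"
  by (auto simp: subspace_arrangement_def arrangement_def arrangement_axioms_def)

lemma rank_function_in_H_space:
  assumes "subspace_arrangement K V n W"
  shows "rank_function K V n W \<in> H_space n"
proof -
  interpret arrangement K V n W using assms by (simp add: subspace_arrangement_iff_locale)
  have "family_sum V W {} = span {}" by (auto simp: family_sum_def span_empty)
  then have "sum_dim K V W {} = 0" using rk_empty by (simp add: sum_dim_def)
  then show ?thesis by (auto simp: H_space_def rank_function_def)
qed

lemma I_functional_rank_function_nonneg:
  assumes "n \<ge> 4" "subspace_arrangement K V n W"
  shows "0 \<le> I_functional n (rank_function K V n W)"
proof -
  interpret arrangement K V n W using assms by (simp add: subspace_arrangement_iff_locale)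
  let ?F = "rank_function K V n W"
  have F: "?F A = real (sum_dim K V W A)" if "A \<subseteq> {1..n}" for A
    using that by (simp add: rank_function_def)
  have "I_functional n ?F = ?F {1, 3} + ?F {1, n} + ?F {2, 3} + (\<Sum>i=4..n. ?F {2, i} + ?F {i - 1, i})
     - ?F {1, 2} - ?F {1, 3, n} - ?F {3} - (\<Sum>i=4..n. ?F {i} + ?F {2, i - 1, i})"
    using rank_function_in_H_space[OF assms(2)] by (simp add: I_functional_def)
  also have "(\<Sum>i=4..n. ?F {2, i} + ?F {i - 1, i}) = real (\<Sum>i=4..n. r {2, i} + r {i - 1, i})"
    unfolding of_nat_sum of_nat_add by (intro sum.cong refl arg_cong2[of _ _ _ _ "(+)"] F) auto
  also have "(\<Sum>i=4..n. ?F {i} + ?F {2, i - 1, i}) = real (\<Sum>i=4..n. r {i} + r {2, i - 1, i})"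
    unfolding of_nat_sum of_nat_add by (intro sum.cong refl arg_cong2[of _ _ _ _ "(+)"] F) auto
  also have "?F {1, 3} = r {1, 3}" using assms by (intro F) auto
  also have "?F {1, n} = r {1, n}" using assms by (intro F) auto
  also have "?F {2, 3} = r {2, 3}" using assms by (intro F) auto
  also have "?F {1, 2} = r {1, 2}" using assms by (intro F) auto
  also have "?F {1, 3, n} = r {1, 3, n}" using assms by (intro F) auto
  also have "?F {3} = r {3}" using assms by (intro F) auto
  finally show ?thesis using sum_dim_inequality[OF assms(1)] by linarith
qed

lemma rank_functions_subset_cone: "rank_functions TYPE('k::infinite) TYPE('v::infinite) n \<subseteq> rank_cone TYPE('k) TYPE('v) n"
proof
  fix F assume "F \<in> rank_functions TYPE('k) TYPE('v) n"
  then show "F \<in> rank_cone TYPE('k) TYPE('v) n"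
    unfolding rank_cone_def mem_Collect_eq
    by (intro exI[of _ "{F}"] exI[of _ "\<lambda>_. 1"]) auto
qed

lemma I_functional_in_dual_cone:
  assumes "n \<ge> 4"
  shows "I_functional n \<in> dual_cone n (rank_cone TYPE('k::infinite) TYPE('v::infinite) n)"
  unfolding dual_cone_def mem_Collect_eq
proof (intro conjI ballI)
  show "I_functional n \<in> H_dual n" by (rule I_functional_in_H_dual)
  fix F assume "F \<in> rank_cone TYPE('k) TYPE('v) n"
  then obtain S c where S: "F = (\<lambda>A. \<Sum>G\<in>S. c G * G A)" "finite S" "S \<subseteq> rank_functions TYPE('k) TYPE('v) n"
    "\<forall>G\<in>S. 0 \<le> c G"
    unfolding rank_cone_def by blast
  have G: "G \<in> H_space n" "0 \<le> I_functional n G" if "G \<in> S" for G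
    using that S(3) rank_function_in_H_space I_functional_rank_function_nonneg[OF assms]
    unfolding rank_functions_def by blast+
  have "I_functional n F = (\<Sum>G\<in>S. c G * I_functional n G)"
    unfolding S(1) using H_dual_sum[OF I_functional_in_H_dual S(2), of "\<lambda>G. G" n c] G(1) by simp
  then show "0 \<le> I_functional n F" using G S(4) by (auto intro!: sum_nonneg)
qed

text \<open>On a tight rank function two nonnegative values add up to 0, so both are 0 and
  proportionality follows. The factor is the value of \<open>f\<close> on a rank function. A general
  \<open>c\<close> covers both irreducibility and the extremal ray.\<close>

lemma summand_of_I_functional:
  assumes n: "n \<ge> 4" and fg: "f \<in> H_dual n" "g \<in> H_dual n"
    and nonneg: "\<forall>F\<in>rank_functions TYPE('k::infinite) TYPE('v::infinite) n. 0 \<le> f F" "\<forall>F\<in>rank_functions TYPE('k) TYPE('v) n. 0 \<le> g F"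
    and sum: "dual_add n f g = dual_scale n c (I_functional n)"
  shows "\<exists>b\<ge>0. f = dual_scale n b (I_functional n)"
proof (intro exI conjI)
  have H: "F \<in> H_space n" if "F \<in> rank_functions TYPE('k) TYPE('v) n" for F
    using that rank_function_in_H_space unfolding rank_functions_def by blast
  have "f F = 0" if F: "F \<in> rank_functions TYPE('k) TYPE('v) n" "I_functional n F = 0" for F
  proof -
    have "f F + g F = c * I_functional n F"
      using fun_cong[OF sum, of F] H[OF F(1)] by (simp add: dual_add_def dual_scale_def)
    then have "f F + g F = 0" using F(2) by simp
    moreover have "0 \<le> f F" "0 \<le> g F" using nonneg F(1) by blast+
    ultimately show ?thesis by linarith
  qed
  then show "f = dual_scale n (f (meets n {1, 2})) (I_functional n)"
    using tight_functional_eq_scale[OF n fg(1)] by blast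
  show "0 \<le> f (meets n {1, 2})" using nonneg meets_in_rank_functions by blast
qed

lemma dual_add_commute: "dual_add n f g = dual_add n g f"
  by (simp add: dual_add_def add.commute)

lemma I_functional_spans_extremal_ray:
  assumes n: "n \<ge> 4"
  shows "spans_extremal_ray n (dual_cone n (rank_cone TYPE('k::infinite) TYPE('v::infinite) n)) (I_functional n)"
  unfolding spans_extremal_ray_def
proof (intro conjI ballI impI)
  show "I_functional n \<in> dual_cone n (rank_cone TYPE('k) TYPE('v) n)"
    using n by (rule I_functional_in_dual_cone)
  show "I_functional n \<noteq> dual_zero n"
    using I_functional_meets_12[OF n] meets_in_H_space[of n "{1, 2}"]
    by (auto simp: dual_zero_def)
  fix f g assume fg: "f \<in> dual_cone n (rank_cone TYPE('k) TYPE('v) n)" "g \<in> dual_cone n (rank_cone TYPE('k) TYPE('v) n)"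
    and "dual_add n f g \<in> dual_ray n (I_functional n)"
  then obtain c where sum: "dual_add n f g = dual_scale n c (I_functional n)"
    by (auto simp: dual_ray_def)
  have nonneg: "\<forall>F\<in>rank_functions TYPE('k) TYPE('v) n. 0 \<le> f F" "\<forall>F\<in>rank_functions TYPE('k) TYPE('v) n. 0 \<le> g F"
    and H: "f \<in> H_dual n" "g \<in> H_dual n"
    using fg rank_functions_subset_cone by (auto simp: dual_cone_def)
  show "f \<in> dual_ray n (I_functional n)"
    using summand_of_I_functional[OF n H nonneg sum] by (auto simp: dual_ray_def)
  show "g \<in> dual_ray n (I_functional n)"
    using summand_of_I_functional[OF n H(2,1) nonneg(2,1)] sum
    by (auto simp: dual_ray_def dual_add_commute[of n g f])
qed

lemma I_functional_irreducible:
  assumes n: "n \<ge> 4"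
  shows "irreducible_functional n (rank_functions TYPE('k::infinite) TYPE('v::infinite) n) (I_functional n)"
  unfolding irreducible_functional_def
proof (intro notI, elim bexE conjE)
  let ?I = "I_functional n"
  fix f g assume H: "f \<in> H_dual n" "g \<in> H_dual n"
    and nonneg: "\<forall>F\<in>rank_functions TYPE('k) TYPE('v) n. 0 \<le> f F" "\<forall>F\<in>rank_functions TYPE('k) TYPE('v) n. 0 \<le> g F"
    and nontrivial: "\<not> (\<exists>c>0. f = dual_scale n c ?I)" "\<not> (\<exists>c>0. g = dual_scale n c ?I)"
    and sum: "?I = dual_add n f g"
  have "dual_scale n 1 ?I = ?I"
    by (rule ext) (simp add: dual_scale_def I_functional_def)
  then have sum': "dual_add n f g = dual_scale n 1 ?I" "dual_add n g f = dual_scale n 1 ?I"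
    using sum dual_add_commute[of n f g] by auto
  obtain b where b: "b \<ge> 0" "f = dual_scale n b ?I"
    using summand_of_I_functional[OF n H nonneg sum'(1)] by blast
  obtain c where c: "c \<ge> 0" "g = dual_scale n c ?I"
    using summand_of_I_functional[OF n H(2,1) nonneg(2,1) sum'(2)] by blast
  \<comment> \<open>Nontriviality forbids positive factors, so both summands are 0 although the
    functional takes the value 1.\<close>
  have "b = 0" "c = 0" using b c nontrivial by force+
  then have "?I (meets n {1, 2}) = 0"
    using b c fun_cong[OF sum, of "meets n {1, 2}"] meets_in_H_space[of n "{1, 2}"]
    by (simp add: dual_add_def dual_scale_def)
  then show False using I_functional_meets_12[OF n] by simp
qed

section \<open>The functional is not a pushforward\<close>

lemma union_preserving_eq_Union:
  assumes "union_preserving k n \<phi>" "\<phi> {} = {}" "A \<subseteq> {1..k}"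
  shows "\<phi> A = (\<Union>i\<in>A. \<phi> {i})"
proof -
  have union: "\<phi> (A \<union> B) = \<phi> A \<union> \<phi> B" if "A \<in> Pow {1..k}" "B \<in> Pow {1..k}" for A B
    using assms(1) that unfolding union_preserving_def by blast
  have "finite A" using assms(3) finite_subset by blast
  then show ?thesis using assms(3)
  proof (induction A rule: finite_induct)
    case (insert i A)
    have "\<phi> ({i} \<union> A) = \<phi> {i} \<union> \<phi> A"
      by (rule union) (use insert.prems in auto)
    then show ?case using insert by simp
  qed (simp add: assms(2))
qed

text \<open>The coefficient at \<open>B\<close> collects the coefficients of \<open>f\<close> at all
  preimages of \<open>B\<close> under \<open>\<phi>\<close>, so it can be nonzero only if there is
  one.\<close>

lemma push_dual_support:
  assumes "B \<in> Pow {1..n} - {{}}" "push_dual k n \<phi> f (unit_fun B) \<noteq> 0"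
  obtains A where "A \<subseteq> {1..k}" "\<phi> A = B"
proof -
  have "unit_fun B \<in> H_space n" using assms(1) by (rule unit_fun_in_H_space)
  then have "(\<Sum>A\<in>Pow {1..k} - {{}}. f (unit_fun A) * unit_fun B (\<phi> A)) \<noteq> 0"
    using assms(2) by (simp add: push_dual_def e_star_def)
  then obtain A where "A \<in> Pow {1..k} - {{}}" "f (unit_fun A) * unit_fun B (\<phi> A) \<noteq> 0"
    by (rule sum.not_neutral_contains_not_neutral)
  then show ?thesis using that by (auto simp: unit_fun_def split: if_splits)
qed

lemma I_functional_unit_single:
  assumes "n \<ge> 4" "3 \<le> m" "m \<le> n"
  shows "I_functional n (unit_fun {m}) = - 1"
proof -
  have H: "unit_fun {m} \<in> H_space n" using assms by (intro unit_fun_in_H_space) auto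
  have "(\<Sum>i=4..n. unit_fun {m} {2, i} + unit_fun {m} {i - 1, i} - unit_fun {m} {i}
      - unit_fun {m} {2, i - 1, i}) = (\<Sum>i=4..n. if i = m then - 1 else 0)"
    by (intro sum.cong refl) (auto simp: unit_fun_def)
  then show ?thesis
    using assms by (subst I_functional_eq[OF H]) (auto simp: unit_fun_def)
qed

lemma I_functional_unit_pair:
  assumes "n \<ge> 4" "a \<in> {1, 2}"
  shows "I_functional n (unit_fun {a, 3}) = 1"
proof -
  have H: "unit_fun {a, 3} \<in> H_space n" using assms by (intro unit_fun_in_H_space) auto
  have "(\<Sum>i=4..n. unit_fun {a, 3} {2, i} + unit_fun {a, 3} {i - 1, i} - unit_fun {a, 3} {i}
      - unit_fun {a, 3} {2, i - 1, i}) = 0"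
  proof (intro sum.neutral ballI)
    fix i assume "i \<in> {4..n}"
    then have "i \<notin> {a, 3}" using assms by auto
    then have "{2, i} \<noteq> {a, 3}" "{i - 1, i} \<noteq> {a, 3}" "{i} \<noteq> {a, 3}" "{2, i - 1, i} \<noteq> {a, 3}"
      by blast+
    then show "unit_fun {a, 3} {2, i} + unit_fun {a, 3} {i - 1, i} - unit_fun {a, 3} {i}
        - unit_fun {a, 3} {2, i - 1, i} = 0"
      by (simp only: unit_fun_def if_False)
  qed
  moreover have "n \<notin> {a, 3}" "3 \<notin> {1, 2 :: nat}" "a \<notin> {3}" using assms by auto
  then have "{1, n} \<noteq> {a, 3}" "{1, 2} \<noteq> {a, 3}" "{1, 3, n} \<noteq> {a, 3}" "{3} \<noteq> {a, 3}"
    by blast+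
  then have "unit_fun {a, 3} {1, n} = 0" "unit_fun {a, 3} {1, 2} = 0"
    "unit_fun {a, 3} {1, 3, n} = 0" "unit_fun {a, 3} {3} = 0"
    by (simp_all only: unit_fun_def if_False)
  moreover have "unit_fun {a, 3} {1, 3} + unit_fun {a, 3} {2, 3} = 1"
    using assms(2) by (auto simp: unit_fun_def doubleton_eq_iff)
  ultimately show ?thesis
    by (subst I_functional_eq[OF H]) simp
qed

lemma I_functional_not_pushforward:
  assumes n: "n \<ge> 4" and "k < n" and \<phi>: "union_preserving k n \<phi>" "\<phi> {} = {}"
  shows "I_functional n \<noteq> push_dual k n \<phi> f"
proof
  assume eq: "I_functional n = push_dual k n \<phi> f"
  \<comment> \<open>One set of the support containing each \<open>m\<close>; \<open>{1}\<close> and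
    \<open>{2}\<close> are not in the support, so pairs with 3 replace them.\<close>
  let ?B = "\<lambda>m. if m \<le> 2 then {m, 3} else {m}"
  have "\<exists>i\<in>{1..k}. m \<in> \<phi> {i} \<and> \<phi> {i} \<subseteq> ?B m" if m: "m \<in> {1..n}" for m
  proof -
    have "I_functional n (unit_fun (?B m)) \<noteq> 0"
    proof (cases "m \<le> 2")
      case True
      then have "m \<in> {1, 2}" using m by auto
      then show ?thesis using I_functional_unit_pair[OF n] True by simp
    next
      case False
      then show ?thesis using I_functional_unit_single[OF n, of m] m by simp
    qed
    moreover have "?B m \<in> Pow {1..n} - {{}}" using m n by auto
    ultimately obtain A where A: "A \<subseteq> {1..k}" "\<phi> A = ?B m"
      using push_dual_support[of "?B m" n k \<phi> f] eq by auto
    then have "m \<in> (\<Union>i\<in>A. \<phi> {i})"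
      using union_preserving_eq_Union[OF \<phi> A(1)] by auto
    then show ?thesis using union_preserving_eq_Union[OF \<phi> A(1)] A by blast
  qed
  then obtain h where h: "\<And>m. m \<in> {1..n} \<Longrightarrow> h m \<in> {1..k} \<and> m \<in> \<phi> {h m} \<and> \<phi> {h m} \<subseteq> ?B m"
    by metis
  have "inj_on h {1..n}"
  proof (rule inj_onI)
    fix a b assume ab: "a \<in> {1..n}" "b \<in> {1..n}" "h a = h b"
    \<comment> \<open>For distinct \<open>a\<close> and \<open>b\<close> the first membership forces
      \<open>a = 3\<close> and \<open>b \<le> 2\<close>, and then \<open>?B a\<close> is
      \<open>{3}\<close>.\<close>
    have "a \<in> ?B b" "b \<in> ?B a" using h[OF ab(1)] h[OF ab(2)] ab(3) by auto
    then show "a = b" by (auto split: if_splits)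
  qed
  moreover have "h ` {1..n} \<subseteq> {1..k}" using h by blast
  ultimately have "card {1..n} \<le> card {1..k}" by (intro card_inj_on_le) auto
  then show False using assms(2) by simp
qed

theorem theorem1p1:
  fixes n :: nat
  assumes "n \<ge> 4"
  shows
    "(\<forall>(K :: 'a ring) (V :: ('a, 'b) module) (W :: nat \<Rightarrow> 'b set).
        subspace_arrangement K V n W \<longrightarrow>
          sum_dim K V W {1, 2} + sum_dim K V W {1, 3, n} + sum_dim K V W {3}
            + (\<Sum>i=4..n. sum_dim K V W {i} + sum_dim K V W {2, i - 1, i})
          \<le> sum_dim K V W {1, 3} + sum_dim K V W {1, n} + sum_dim K V W {2, 3}
            + (\<Sum>i=4..n. sum_dim K V W {2, i} + sum_dim K V W {i - 1, i}))
     \<and> irreducible_functional n (rank_functions TYPE('k::infinite) TYPE('v::infinite) n) (I_functional n)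
     \<and> spans_extremal_ray n (dual_cone n (rank_cone TYPE('k) TYPE('v) n)) (I_functional n)
     \<and> (\<forall>k<n. \<forall>\<phi>. union_preserving k n \<phi> \<and> \<phi> {} = {} \<longrightarrow>
          I_functional n \<notin> push_dual k n \<phi> ` dual_cone k (rank_cone TYPE('k) TYPE('v) k))"
  using arrangement.sum_dim_inequality[OF _ assms] I_functional_irreducible[OF assms]
    I_functional_spans_extremal_ray[OF assms] I_functional_not_pushforward[OF assms]
  unfolding subspace_arrangement_iff_locale by blast

end
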